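(* Let $\Omega\subset\subset\mathbb{R}^N$ be a (bounded) domain satisfying the segment property, and let $M:\Omega\times\mathbb{R}^+\to\mathbb{R}^+$ be an $N$-function which, for some $p>1$, satisfies $(\mathcal{M}1)$, the growth condition $(\mathrm{G}_p)$ and $(\mathcal{M}2p)$. Then for every $u\in W^{1,p}_0(\Omega)\cap V^1_0L_M(\Omega)$ with $\operatorname{supp}u\subset\subset\Omega$ there exists a sequence of functions $u_k\in\mathcal{C}_0^\infty(\Omega)$ such that, as $k\to\infty$, $u_k\to u$ strongly in $W^{1,p}(\Omega)$ and $Du_k\to Du$ modularly in $L_M(\Omega)$, i.e. there is $\lambda>0$ with $\int_\Omega M\big(x,|Du_k-Du|/\lambda\big)dx\to0$.
   Context: A function $M:\Omega\times\mathbb{R}^+\to\mathbb{R}^+$ is a $\phi$-function if $x\mapsto M(x,s)$ is measurable for all $s\ge0$, $s\mapsto M(x,s)$ is convex for a.e. $x\in\Omega$ with $M(x,0)=0$, $\operatorname{ess\,inf}_{x\in\Omega}M(x,1)>0$, and $M(x,s)\to+\infty$ as $s\to+\infty$. It is a $\Phi$-function if moreover, for a.e. $x$, $\lim_{s\to0}M(x,s)/s=0$ and $\lim_{s\to\infty}M(x,s)/s=\infty$. An $N$-function is a $\Phi$-function that is strictly increasing in $s$. Conditions: $(\mathcal{M}1)$: for every constant $c>0$ and every compact $K\subset\Omega$, $\int_K M(x,c)\,dx<\infty$. $(\mathrm{G}_p)$: $M(x,s)\ge c|s|^p$ for some constant $c>0$, where $p>1$. $(\mathcal{M}2p)$: there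 is a function $\varphi:[0,1/2]\times\mathbb{R}^+\to\mathbb{R}^+$, nondecreasing in each of its two variables separately, such that $M(x,s)\le\varphi(|x-y|,s)M(y,s)$ for all $x,y\in\overline\Omega$ with $|x-y|\le\frac12$ (and all $s\ge0$), and such that $\limsup_{\varepsilon\to0^+}\varphi(\varepsilon,c\,\varepsilon^{-N/p})<\infty$ for every constant $c>0$ (same $p$ as in $(\mathrm{G}_p)$). Segment property: there exist a finite open covering $\{\theta_i\}_{i=1}^k$ of $\overline\Omega$ and corresponding nonzero vectors $z_i\in\mathbb{R}^N$ such that $(\overline\Omega\cap\theta_i)+tz_i\subset\Omega$ for all $t\in(0,1)$ and $i=1,\dots,k$. $L_M(\Omega)$ is the set of measurable $u$ with $\int_\Omega M(x,|u(x)|/\lambda)dx<\infty$ for some $\lambda>0$ (also used for vector-valued functions, with $|\cdot|$ the Euclidean norm). $V^1_0L_M(\Omega)=\{u\in W^{1,1}_0(\Omega): Du\in L_M(\Omega)\}$, where $W^{1,1}_0(\Omega)$ is the closure of $\mathcal{C}_0^\infty(\Omega)$ in $W^{1,1}(\Omega)$. $\mathcal{C}_0^\infty(\Omega)$ is the set of smooth functions compactly supported in $\Omega$. *)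

theory Defs
  imports "HOL-Analysis.Analysis" "HOL-Probability.Essential_Supremum"
begin

subsection \<open>Domains\<close>

definition compactly_contained :: "'a::topological_space set \<Rightarrow> 'a set \<Rightarrow> bool"
  where "compactly_contained A B \<longleftrightarrow> compact (closure A) \<and> closure A \<subseteq> B"

definition segment_property :: "(real^'n) set \<Rightarrow> bool" where
  "segment_property \<Omega> \<longleftrightarrow>
    (\<exists>(k::nat) (\<theta> :: nat \<Rightarrow> (real^'n) set) (z :: nat \<Rightarrow> real^'n).
      (\<forall>i\<in>{1..k}. open (\<theta> i) \<and> z i \<noteq> 0) \<and>
      closure \<Omega> \<subseteq> (\<Union>i\<in>{1..k}. \<theta> i) \<and>
      (\<forall>i\<in>{1..k}. \<forall>t\<in>{0<..<1}. (\<lambda>x. x + t *\<^sub>R z i) ` (closure \<Omega> \<inter> \<theta> i) \<subseteq> \<Omega>))"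


subsection \<open>Generalised Young functions\<close>

text \<open>
  A function on \<open>\<Omega> \<times> [0, \<infinity>)\<close> with values in \<open>[0, \<infinity>)\<close> is a total curried function whose
  values outside this set (apart from those on the boundary of \<open>\<Omega>\<close> that enter \<open>cond_M2p\<close>)
  are irrelevant.
\<close>

definition ess_inf :: "'a measure \<Rightarrow> ('a \<Rightarrow> ereal) \<Rightarrow> ereal"
  where "ess_inf \<mu> f = - esssup \<mu> (\<lambda>x. - f x)"

definition phi_function :: "(real^'n) set \<Rightarrow> (real^'n \<Rightarrow> real \<Rightarrow> real) \<Rightarrow> bool" where
  "phi_function \<Omega> M \<longleftrightarrow>
    (\<forall>x\<in>\<Omega>. \<forall>s\<ge>0. 0 \<le> M x s) \<and>
    (\<forall>s\<ge>0. (\<lambda>x. M x s) \<in> borel_measurable (lebesgue_on \<Omega>)) \<and>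
    (AE x in lebesgue_on \<Omega>. convex_on {0..} (M x) \<and> M x 0 = 0) \<and>
    ess_inf (lebesgue_on \<Omega>) (\<lambda>x. ereal (M x 1)) > 0 \<and>
    (AE x in lebesgue_on \<Omega>. filterlim (M x) at_top at_top)"

definition Phi_function :: "(real^'n) set \<Rightarrow> (real^'n \<Rightarrow> real \<Rightarrow> real) \<Rightarrow> bool" where
  "Phi_function \<Omega> M \<longleftrightarrow>
    phi_function \<Omega> M \<and>
    (AE x in lebesgue_on \<Omega>. ((\<lambda>s. M x s / s) \<longlongrightarrow> 0) (at_right 0)) \<and>
    (AE x in lebesgue_on \<Omega>. filterlim (\<lambda>s. M x s / s) at_top at_top)"

definition N_function :: "(real^'n) set \<Rightarrow> (real^'n \<Rightarrow> real \<Rightarrow> real) \<Rightarrow> bool" where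
  "N_function \<Omega> M \<longleftrightarrow>
    Phi_function \<Omega> M \<and> (AE x in lebesgue_on \<Omega>. strict_mono_on {0..} (M x))"

definition cond_M1 :: "(real^'n) set \<Rightarrow> (real^'n \<Rightarrow> real \<Rightarrow> real) \<Rightarrow> bool" where
  "cond_M1 \<Omega> M \<longleftrightarrow>
    (\<forall>c>0. \<forall>K. compact K \<and> K \<subseteq> \<Omega> \<longrightarrow> (\<integral>\<^sup>+x\<in>K. ennreal (M x c) \<partial>lebesgue) < \<infinity>)"

definition cond_Gp :: "(real^'n) set \<Rightarrow> (real^'n \<Rightarrow> real \<Rightarrow> real) \<Rightarrow> real \<Rightarrow> bool" where
  "cond_Gp \<Omega> M p \<longleftrightarrow> (\<exists>c>0. AE x in lebesgue_on \<Omega>. \<forall>s\<ge>0. M x s \<ge> c * \<bar>s\<bar> powr p)"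

definition cond_M2p :: "(real^'n) set \<Rightarrow> (real^'n \<Rightarrow> real \<Rightarrow> real) \<Rightarrow> real \<Rightarrow> bool" where
  "cond_M2p \<Omega> M p \<longleftrightarrow>
    (\<exists>\<phi> :: real \<Rightarrow> real \<Rightarrow> real.
      (\<forall>r\<in>{0..1/2}. \<forall>s\<ge>0. 0 \<le> \<phi> r s) \<and>
      (\<forall>s\<ge>0. mono_on {0..1/2} (\<lambda>r. \<phi> r s)) \<and>
      (\<forall>r\<in>{0..1/2}. mono_on {0..} (\<phi> r)) \<and>
      (\<forall>x\<in>closure \<Omega>. \<forall>y\<in>closure \<Omega>. norm (x - y) \<le> 1/2 \<longrightarrow>
        (\<forall>s\<ge>0. M x s \<le> \<phi> (norm (x - y)) s * M y s)) \<and>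
      (\<forall>c>0. Limsup (at_right 0)
        (\<lambda>\<epsilon>. ereal (\<phi> \<epsilon> (c * \<epsilon> powr (- (real CARD('n) / p))))) < \<infinity>))"


subsection \<open>Musielak--Orlicz spaces\<close>

definition L_M :: "(real^'n) set \<Rightarrow> (real^'n \<Rightarrow> real \<Rightarrow> real) \<Rightarrow> (real^'n \<Rightarrow> 'b::real_normed_vector) set"
  where
  "L_M \<Omega> M = {f \<in> borel_measurable (lebesgue_on \<Omega>).
     \<exists>l>0. (\<integral>\<^sup>+x\<in>\<Omega>. ennreal (M x (norm (f x) / l)) \<partial>lebesgue) < \<infinity>}"

definition modular_convergence ::
  "(real^'n) set \<Rightarrow> (real^'n \<Rightarrow> real \<Rightarrow> real) \<Rightarrow>
    (nat \<Rightarrow> real^'n \<Rightarrow> 'b::real_normed_vector) \<Rightarrow> (real^'n \<Rightarrow> 'b) \<Rightarrow> bool" where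
  "modular_convergence \<Omega> M f g \<longleftrightarrow>
    (\<exists>l>0. (\<lambda>k. \<integral>\<^sup>+x\<in>\<Omega>. ennreal (M x (norm (f k x - g x) / l)) \<partial>lebesgue) \<longlonglongrightarrow> 0)"


subsection \<open>Test functions, weak gradients and Sobolev spaces\<close>

primrec Ck :: "nat \<Rightarrow> (real^'n \<Rightarrow> real) \<Rightarrow> bool" where
  "Ck 0 f \<longleftrightarrow> continuous_on UNIV f"
| "Ck (Suc k) f \<longleftrightarrow>
    (\<forall>x. f differentiable (at x)) \<and> (\<forall>v. Ck k (\<lambda>x. frechet_derivative f (at x) v))"

text \<open>
  A function in \<open>C0_inf \<Omega>\<close> is identified with its extension by zero, which is smooth on the
  whole space.
\<close>

definition C0_inf :: "(real^'n) set \<Rightarrow> (real^'n \<Rightarrow> real) set"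
  where "C0_inf \<Omega> = {f. (\<forall>k. Ck k f) \<and> compactly_contained {x. f x \<noteq> 0} \<Omega>}"

definition has_weak_gradient ::
  "(real^'n) set \<Rightarrow> (real^'n \<Rightarrow> real) \<Rightarrow> (real^'n \<Rightarrow> real^'n) \<Rightarrow> bool" where
  "has_weak_gradient \<Omega> u g \<longleftrightarrow>
    (\<forall>K. compact K \<and> K \<subseteq> \<Omega> \<longrightarrow> set_integrable lebesgue K u \<and> set_integrable lebesgue K g) \<and>
    (\<forall>\<psi>\<in>C0_inf \<Omega>. \<forall>i.
      (LINT x:\<Omega>|lebesgue. u x * frechet_derivative \<psi> (at x) (axis i 1)) =
      - (LINT x:\<Omega>|lebesgue. g x $ i * \<psi> x))"

text \<open>
  The weak gradient is unique up to null sets; \<open>weak_grad\<close> picks a representative, and is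
  meaningful only for functions that have a weak gradient.
\<close>

definition weak_grad :: "(real^'n) set \<Rightarrow> (real^'n \<Rightarrow> real) \<Rightarrow> real^'n \<Rightarrow> real^'n"
  where "weak_grad \<Omega> u = (SOME g. has_weak_gradient \<Omega> u g)"

definition Lp :: "real \<Rightarrow> (real^'n) set \<Rightarrow> (real^'n \<Rightarrow> 'b::real_normed_vector) set" where
  "Lp p \<Omega> = {f \<in> borel_measurable (lebesgue_on \<Omega>).
     set_integrable lebesgue \<Omega> (\<lambda>x. norm (f x) powr p)}"

text \<open>The two norms below are meaningful only on the corresponding spaces.\<close>

definition Lp_norm :: "real \<Rightarrow> (real^'n) set \<Rightarrow> (real^'n \<Rightarrow> 'b::real_normed_vector) \<Rightarrow> real"
  where "Lp_norm p \<Omega> f = (LINT x:\<Omega>|lebesgue. norm (f x) powr p) powr (1 / p)"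

definition W1 :: "real \<Rightarrow> (real^'n) set \<Rightarrow> (real^'n \<Rightarrow> real) set"
  where "W1 p \<Omega> = {u \<in> Lp p \<Omega>. \<exists>g. has_weak_gradient \<Omega> u g \<and> g \<in> Lp p \<Omega>}"

definition W1_norm :: "real \<Rightarrow> (real^'n) set \<Rightarrow> (real^'n \<Rightarrow> real) \<Rightarrow> real"
  where "W1_norm p \<Omega> u = Lp_norm p \<Omega> u + Lp_norm p \<Omega> (weak_grad \<Omega> u)"

definition W1_0 :: "real \<Rightarrow> (real^'n) set \<Rightarrow> (real^'n \<Rightarrow> real) set" where
  "W1_0 p \<Omega> = {u \<in> W1 p \<Omega>. \<forall>e>0. \<exists>\<psi>\<in>C0_inf \<Omega>. W1_norm p \<Omega> (\<lambda>x. \<psi> x - u x) < e}"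

definition V1_0_L_M :: "(real^'n) set \<Rightarrow> (real^'n \<Rightarrow> real \<Rightarrow> real) \<Rightarrow> (real^'n \<Rightarrow> real) set"
  where "V1_0_L_M \<Omega> M = {u \<in> W1_0 1 \<Omega>. weak_grad \<Omega> u \<in> L_M \<Omega> M}"

text \<open>
  Elements of Sobolev spaces are functions modulo null sets, so their support is the
  complement in \<open>\<Omega>\<close> of the largest open set on which the function vanishes almost everywhere.
\<close>

definition ess_support :: "(real^'n) set \<Rightarrow> (real^'n \<Rightarrow> real) \<Rightarrow> (real^'n) set" where
  "ess_support \<Omega> u = \<Omega> - \<Union>{U. open U \<and> U \<subseteq> \<Omega> \<and> (AE x in lebesgue_on U. u x = 0)}"

end

theory Submission
  imports Defs
begin

text \<open>
  Since \<open>u\<close> has compact support in \<open>\<Omega>\<close>, its mollifications \<open>u\<^sub>r = J\<^sub>r * u\<close> are test functions with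
  gradient \<open>J\<^sub>r * Du\<close> for small \<open>r\<close>. The modular of \<open>J\<^sub>r * Du\<close> is controlled without passing to the convex
  envelope of the local infimum of \<open>M\<close>. Write \<open>g = Du\<close> and put \<open>\<tau> = \<bar>J\<^sub>r * g\<bar>(x) / 2\<close>. The points \<open>y\<close> near \<open>x\<close> with \<open>\<bar>g(y)\<bar> \<ge> \<tau>\<close>
  contribute at least \<open>\<tau>\<close> to the average \<open>J\<^sub>r * \<bar>g\<bar>\<close> at \<open>x\<close>, and there convexity gives
  \<open>M(y, \<bar>g(y)\<bar>) \<ge> M(y, \<tau>) \<bar>g(y)\<bar> / \<tau>\<close>. If \<open>M(x, \<tau>) \<le> C M(y, \<tau>)\<close> for these \<open>y\<close>, it follows that
  \<open>M(x, \<tau>) \<le> C (J\<^sub>r * M(\<cdot>, \<bar>g\<bar>))(x)\<close>. The same inequality for \<open>s\<^sup>p\<close> in place of \<open>M\<close> shows that \<open>\<tau>\<close> is at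
  most of order \<open>r powr (- N / p)\<close>, so that \<open>cond_M2p\<close> provides the constant \<open>C\<close>. The right-hand sides converge in \<open>L\<^sup>1\<close>
  as \<open>r\<close> tends to \<open>0\<close>, and dominated convergence along fast subsequences gives modular convergence,
  for \<open>M\<close> as well as for \<open>s\<^sup>p\<close>.
\<close>

subsection \<open>Smooth bump functions\<close>

text \<open>The obstacle is that \<open>cond_M2p\<close> bounds \<open>M x s / M y s\<close>
  uniformly only for \<open>s\<close> up to order \<open>r powr (- N / p)\<close>, whereas the
  values of the gradient are unbounded. Jensen's inequality for \<open>M x\<close> would need the
  comparison at height \<open>norm (g y)\<close>. The chord through the origin moves it to the
  height \<open>\<tau>\<close> of the mollified gradient. This height is admissible because the
  kernel is at most \<open>A / r ^ N\<close>: the p-th power of \<open>\<tau>\<close> is then at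
  most \<open>A / r ^ N\<close> times the integral of \<open>norm (g y) powr p\<close>, and the p-th
  root gives the exponent \<open>- N / p\<close>. Here the integrability of order p of the gradient
  enters. The factor 2 in \<open>\<tau>\<close> lets the points with
  \<open>norm (g y) < \<tau>\<close> be discarded: the kernel has mass 1, so they contribute at most
  \<open>\<tau>\<close> to an average of at least \<open>2 * \<tau>\<close>. A second factor 2 is
  lost when the difference of the mollified and the original gradient is split by convexity. Hence
  the 4 in all limits below, and the modular scale \<open>4 * l\<close> at the end.\<close>

lemma Ck_imp_continuous: "Ck k f \<Longrightarrow> continuous_on UNIV f"
  by (cases k) (auto intro!: continuous_at_imp_continuous_on differentiable_imp_continuous_within)

lemma Ck_SucI:
  assumes "\<And>x. (f has_derivative f' x) (at x)" "\<And>v. Ck k (\<lambda>x. f' x v)"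
  shows "Ck (Suc k) f"
proof -
  have "frechet_derivative f (at x) = f' x" for x
    using assms(1) frechet_derivative_at[of f "f' x" x] by simp
  with assms show ?thesis by (auto simp: differentiable_def)
qed

lemma Ck_Suc_has_derivative:
  "Ck (Suc k) f \<Longrightarrow> (f has_derivative frechet_derivative f (at x)) (at x)"
  using frechet_derivative_works[of f "at x"] by simp

lemma Ck_Suc_imp_Ck: "Ck (Suc k) f \<Longrightarrow> Ck k f"
proof (induction k arbitrary: f)
  case 0
  then show ?case using Ck_imp_continuous[OF 0] by simp
next
  case (Suc k)
  from Suc.prems have d: "\<forall>x. f differentiable (at x)"
    and c: "\<And>v. Ck (Suc k) (\<lambda>x. frechet_derivative f (at x) v)" by auto
  from c have "\<And>v. Ck k (\<lambda>x. frechet_derivative f (at x) v)" by (rule Suc.IH)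
  with d show ?case by auto
qed

lemma Ck_const: "Ck k (\<lambda>x. c)"
proof (induction k arbitrary: c)
  case (Suc k)
  show ?case by (rule Ck_SucI[where f' = "\<lambda>x v. 0"]) (auto intro: derivative_eq_intros Suc)
qed auto

lemma Ck_add: "Ck k f \<Longrightarrow> Ck k g \<Longrightarrow> Ck k (\<lambda>x. f x + g x)"
proof (induction k arbitrary: f g)
  case 0
  then show ?case by (auto intro: continuous_intros)
next
  case (Suc k)
  show ?case
  proof (rule Ck_SucI)
    show "((\<lambda>x. f x + g x) has_derivative
        (\<lambda>v. frechet_derivative f (at x) v + frechet_derivative g (at x) v)) (at x)" for x
      using Suc.prems by (intro has_derivative_add Ck_Suc_has_derivative)
    show "Ck k (\<lambda>x. frechet_derivative f (at x) v + frechet_derivative g (at x) v)" for v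
      using Suc by simp
  qed
qed

lemma Ck_mult: "Ck k f \<Longrightarrow> Ck k g \<Longrightarrow> Ck k (\<lambda>x. f x * g x)"
proof (induction k arbitrary: f g)
  case 0
  then show ?case by (auto intro: continuous_intros)
next
  case (Suc k)
  show ?case
  proof (rule Ck_SucI)
    show "((\<lambda>x. f x * g x) has_derivative
        (\<lambda>v. f x * frechet_derivative g (at x) v + frechet_derivative f (at x) v * g x)) (at x)" for x
      using Suc.prems by (intro has_derivative_mult Ck_Suc_has_derivative)
    show "Ck k (\<lambda>x. f x * frechet_derivative g (at x) v + frechet_derivative f (at x) v * g x)" for v
      using Suc.prems by (intro Ck_add Suc.IH Ck_Suc_imp_Ck[OF Suc.prems(1)] Ck_Suc_imp_Ck[OF Suc.prems(2)]) auto
  qed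
qed

lemma Ck_bounded_linear: "bounded_linear f \<Longrightarrow> Ck k f"
proof (cases k)
  case (Suc j)
  assume "bounded_linear f"
  then show ?thesis unfolding Suc
    by (intro Ck_SucI[where f' = "\<lambda>x. f"]) (auto intro: bounded_linear_imp_has_derivative Ck_const)
qed (auto intro: linear_continuous_on)

text \<open>For \<open>m = 0\<close> this is the classical function \<open>exp (- (1 / t))\<close>
  continued by 0. Admitting powers of \<open>t\<close> in the denominator makes the family closed
  under differentiation up to linear combinations.\<close>

definition flat :: "nat \<Rightarrow> real \<Rightarrow> real" where
  "flat m t = (if t > 0 then exp (- (1 / t)) / t ^ m else 0)"

lemma flat_nonneg: "flat m t \<ge> 0"
  by (simp add: flat_def)

text \<open>With \<open>x = 1 / t\<close>, a single term of the exponential series suffices: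
  \<open>x ^ (m + 2) / fact (m + 2) \<le> exp x\<close>. The order 2 makes the difference quotient
  at the origin tend to 0.\<close>

lemma flat_abs_le: "\<bar>flat m t\<bar> \<le> fact (m + 2) * t\<^sup>2"
proof (cases "t > 0")
  case True
  define x where "x = 1 / t"
  have x: "x > 0" "t = 1 / x" using True by (auto simp: x_def)
  have "x ^ (m + 2) / fact (m + 2) \<le> exp x"
  proof -
    have "(\<Sum>n\<in>{m+2}. inverse (fact n) * x ^ n) \<le> (\<Sum>n. inverse (fact n) * x ^ n)"
      using x summable_exp[of x] by (intro sum_le_suminf) (auto simp: mult.commute)
    then show ?thesis by (simp add: exp_def divide_inverse scaleR_conv_of_real mult.commute)
  qed
  then have "x ^ m * x\<^sup>2 \<le> fact (m + 2) * exp x"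
    using fact_gt_zero[of "m + 2", where ?'a = real]
    by (simp add: power_add pos_divide_le_eq mult_ac power2_eq_square del: fact_Suc)
  then have "x ^ m * exp (- x) \<le> fact (m + 2) / x\<^sup>2"
    using x by (simp add: exp_minus field_simps del: fact_Suc)
  then show ?thesis using x(1) unfolding x(2)
    by (simp add: flat_def power_divide mult.commute del: fact_Suc)
qed (simp add: flat_def)

lemma flat_has_real_derivative:
  "(flat m has_real_derivative (flat (m + 2) t - real m * flat (m + 1) t)) (at t)"
proof -
  consider "t > 0" | "t < 0" | "t = 0" by linarith
  then show ?thesis
  proof cases
    case 1
    have "((\<lambda>t. exp (- (1 / t)) / t ^ m) has_real_derivative
        (flat (m + 2) t - real m * flat (m + 1) t)) (at t)"
    proof (rule DERIV_cong)
      show "((\<lambda>t. exp (- (1 / t)) / t ^ m) has_real_derivative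
          (exp (- (1 / t)) * (1 / t\<^sup>2) * t ^ m - exp (- (1 / t)) * (real m * t ^ (m - 1)))
            / (t ^ m * t ^ m)) (at t)"
        using 1 by (auto intro!: derivative_eq_intros simp: power2_eq_square)
      show "(exp (- (1 / t)) * (1 / t\<^sup>2) * t ^ m - exp (- (1 / t)) * (real m * t ^ (m - 1)))
            / (t ^ m * t ^ m) = flat (m + 2) t - real m * flat (m + 1) t"
        using 1 by (cases m) (simp_all add: flat_def divide_simps power2_eq_square, simp_all add: algebra_simps)
    qed
    then show ?thesis
      by (rule has_field_derivative_transform_within_open[where S = "{0<..}"])
         (use 1 in \<open>auto simp: flat_def\<close>)
  next
    case 2
    have "((\<lambda>t. 0) has_real_derivative (flat (m + 2) t - real m * flat (m + 1) t)) (at t)"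
      using 2 by (auto simp: flat_def)
    then show ?thesis
      by (rule has_field_derivative_transform_within_open[where S = "{..<0}"])
         (use 2 in \<open>auto simp: flat_def\<close>)
  next
    case 3
    have "((\<lambda>h. flat m h / h) \<longlongrightarrow> 0) (at 0)"
    proof (rule Lim_null_comparison)
      show "((\<lambda>h::real. fact (m + 2) * \<bar>h\<bar>) \<longlongrightarrow> 0) (at 0)"
        by (auto intro!: tendsto_eq_intros)
      show "\<forall>\<^sub>F h in at 0. norm (flat m h / h) \<le> fact (m + 2) * \<bar>h\<bar>"
      proof (rule eventually_at_topological[THEN iffD2], intro exI[of _ UNIV] conjI ballI impI)
        fix h :: real assume "h \<noteq> 0"
        then show "norm (flat m h / h) \<le> fact (m + 2) * \<bar>h\<bar>"
          using flat_abs_le[of m h]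
          by (simp add: abs_divide pos_divide_le_eq power2_eq_square mult.assoc abs_mult_self_eq
              flip: abs_mult)
      qed auto
    qed
    moreover have "flat k 0 = 0" for k by (simp add: flat_def)
    ultimately show ?thesis using 3 by (simp add: has_field_derivative_iff)
  qed
qed

text \<open>The chain rule leads from \<open>m\<close> to \<open>m + 1\<close> and
  \<open>m + 2\<close>, so the induction on \<open>k\<close> runs over all \<open>m\<close>
  simultaneously.\<close>

lemma Ck_flat_compose:
  assumes "\<And>k. Ck k q"
  shows "Ck k (\<lambda>x. flat m (q x))"
proof (induction k arbitrary: m)
  case 0
  have "continuous_on UNIV (flat m)"
    using flat_has_real_derivative by (meson DERIV_isCont continuous_at_imp_continuous_on)
  then have "continuous_on UNIV (flat m \<circ> q)"
    using Ck_imp_continuous[OF assms[of 0]] by (intro continuous_on_compose) (auto intro: continuous_on_subset)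
  then show ?case by (simp add: o_def)
next
  case (Suc k)
  have q: "Ck (Suc k) q" by (rule assms)
  show ?case
  proof (rule Ck_SucI)
    show "((\<lambda>x. flat m (q x)) has_derivative
      (\<lambda>v. (flat (m + 2) (q x) + (- real m) * flat (m + 1) (q x)) * frechet_derivative q (at x) v)) (at x)" for x
      using has_derivative_compose[OF Ck_Suc_has_derivative[OF q, of x]
        flat_has_real_derivative[of m "q x", unfolded has_field_derivative_def]]
      by simp
    show "Ck k (\<lambda>x. (flat (m + 2) (q x) + (- real m) * flat (m + 1) (q x)) * frechet_derivative q (at x) v)" for v
      using q by (intro Ck_mult Ck_add Ck_const Suc) auto
  qed
qed

text \<open>The squared norm is a polynomial in the coordinates, which keeps the function smooth at
  the centre, where the norm itself is not.\<close>

definition bump :: "real \<Rightarrow> real^'n \<Rightarrow> real" where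
  "bump r z = flat 0 (1 - (norm z)\<^sup>2 / r\<^sup>2)"

lemma Ck_bump_shift: "Ck k (\<lambda>y. bump r (y - a))"
proof -
  have 1: "(norm (y - a))\<^sup>2 = (\<Sum>i\<in>UNIV. (y $ i + - a $ i) * (y $ i + - a $ i))" for y
    by (simp add: norm_vec_def L2_set_def real_sqrt_pow2 sum_nonneg power2_eq_square)
  have s: "Ck k (\<lambda>y. \<Sum>i\<in>I. f i y)" if "finite I" "\<And>i. Ck k (f i)" for I :: "'a set" and f :: "'a \<Rightarrow> real^'a \<Rightarrow> real" and k
    using that(1) by induction (auto intro: Ck_const Ck_add that)
  have "Ck k (\<lambda>y. 1 + (- (1 / r\<^sup>2)) * (norm (y - a))\<^sup>2)" for k
    unfolding 1 by (intro Ck_add Ck_mult Ck_const s Ck_bounded_linear bounded_linear_vec_nth) auto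
  from Ck_flat_compose[OF this, of k 0] show ?thesis
    by (simp add: bump_def)
qed

lemma bump_nonneg: "bump r z \<ge> 0"
  by (simp add: bump_def flat_nonneg)

lemma bump_minus: "bump r (- z) = bump r z"
  by (simp add: bump_def)

lemma bump_eq_0: "r > 0 \<Longrightarrow> norm z \<ge> r \<Longrightarrow> bump r z = 0"
  by (auto simp: bump_def flat_def divide_simps power_strict_mono intro: power_mono dest: power_mono[of r _ 2])

lemma bump_le_1: "bump r z \<le> 1"
  by (simp add: bump_def flat_def)

text \<open>Within half the radius the argument of \<open>flat\<close> is at least 3/4; the cruder
  value 1/2 gives \<open>exp (- 2)\<close>. This bounds the integral of the bump from below by a
  multiple of \<open>r ^ N\<close>, hence the normalised kernel from above.\<close>

lemma bump_ge:
  assumes "norm z \<le> r / 2" "r > 0"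
  shows "bump r z \<ge> exp (- 2)"
proof -
  have "(norm z)\<^sup>2 \<le> (r / 2)\<^sup>2" using assms by (intro power_mono) auto
  then have *: "(norm z)\<^sup>2 / r\<^sup>2 \<le> 1 / 4" using assms by (simp add: power_divide field_simps)
  define q where "q = 1 - (norm z)\<^sup>2 / r\<^sup>2"
  have q: "q \<ge> 1 / 2" unfolding q_def using * by linarith
  then have "1 / q \<le> 2" by (subst pos_divide_le_eq) auto
  with q show ?thesis by (simp add: bump_def flat_def flip: q_def)
qed

subsection \<open>Convolution with a compactly supported kernel\<close>

text \<open>Scalar multiplication admits vector-valued \<open>f\<close>, so that \<open>u\<close>
  and its gradient are mollified by the same operator.\<close>

definition conv :: "(real^'n \<Rightarrow> real) \<Rightarrow> (real^'n \<Rightarrow> 'b) \<Rightarrow> real^'n \<Rightarrow> 'b::euclidean_space" where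
  "conv \<psi> f x = (LINT y|lebesgue. \<psi> (x - y) *\<^sub>R f y)"

lemma compact_support_bounded:
  fixes \<psi> :: "real^'n \<Rightarrow> real"
  assumes "continuous_on UNIV \<psi>" "\<And>z. norm z \<ge> R \<Longrightarrow> \<psi> z = 0"
  shows "\<exists>B>0. \<forall>z. \<bar>\<psi> z\<bar> \<le> B"
proof -
  have "compact (\<psi> ` cball 0 R)"
    by (rule compact_continuous_image[OF continuous_on_subset[OF assms(1) subset_UNIV] compact_cball])
  then obtain B where B: "B > 0" "\<forall>y\<in>\<psi> ` cball 0 R. norm y \<le> B"
    using compact_imp_bounded bounded_pos by blast
  have "\<bar>\<psi> z\<bar> \<le> B" for z
  proof (cases "norm z \<le> R")
    case True
    then have "\<psi> z \<in> \<psi> ` cball 0 R" by simp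
    with B(2) show ?thesis by (metis real_norm_def)
  next
    case False
    then show ?thesis using assms(2)[of z] B(1) by simp
  qed
  with B(1) show ?thesis by blast
qed

lemma compact_support_uniformly_continuous:
  fixes \<psi> :: "real^'n \<Rightarrow> 'b::real_normed_vector"
  assumes "continuous_on UNIV \<psi>" "\<And>z. norm z \<ge> R \<Longrightarrow> \<psi> z = 0" "e > 0"
  shows "\<exists>d>0. \<forall>z w. norm (w - z) < d \<longrightarrow> norm (\<psi> w - \<psi> z) < e"
proof -
  \<comment> \<open>The radius exceeds \<open>\<bar>R\<bar>\<close> by 1: of two points at distance
    less than 1, either both lie in this ball or both lie where the function vanishes.\<close>
  have "uniformly_continuous_on (cball 0 (\<bar>R\<bar> + 1)) \<psi>"
    using assms(1) by (intro compact_uniformly_continuous continuous_on_subset[OF assms(1)]) auto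
  then obtain d where d: "d > 0" "\<forall>z\<in>cball 0 (\<bar>R\<bar> + 1). \<forall>w\<in>cball 0 (\<bar>R\<bar> + 1).
      dist w z < d \<longrightarrow> dist (\<psi> w) (\<psi> z) < e"
    unfolding uniformly_continuous_on_def by (elim allE[of _ e] impE[OF _ assms(3)] exE conjE)
  have "norm (\<psi> w - \<psi> z) < e" if wz: "norm (w - z) < min d 1" for z w
  proof (cases "norm z \<le> \<bar>R\<bar> + 1 \<and> norm w \<le> \<bar>R\<bar> + 1")
    case True
    then have "z \<in> cball 0 (\<bar>R\<bar> + 1)" "w \<in> cball 0 (\<bar>R\<bar> + 1)" by simp_all
    with d(2) wz show ?thesis by (simp add: dist_norm)
  next
    case False
    have "norm w \<le> norm z + norm (w - z)" "norm z \<le> norm w + norm (w - z)"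
      using norm_triangle_ineq2[of w z] norm_triangle_ineq2[of z w] norm_minus_commute[of w z] by linarith+
    with False wz have "norm z \<ge> R" "norm w \<ge> R" by linarith+
    then show ?thesis using assms(2,3) by simp
  qed
  with d(1) show ?thesis by (intro exI[of _ "min d 1"]) auto
qed

lemma measurable_shift:
  assumes "continuous_on UNIV (\<psi> :: real^'n \<Rightarrow> real)"
  shows "(\<lambda>y. \<psi> (x - y)) \<in> borel_measurable lebesgue"
proof -
  have "(\<lambda>y. \<psi> (x - y)) \<in> borel_measurable borel"
    using assms by (intro borel_measurable_continuous_onI continuous_on_compose2[OF assms] continuous_intros) auto
  then show ?thesis by (intro measurable_completion) simp
qed

lemma integrable_scaleR_bounded:
  fixes f :: "'a \<Rightarrow> 'b::euclidean_space" and a :: "'a \<Rightarrow> real"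
  assumes "integrable M f" "a \<in> borel_measurable M" "\<And>y. \<bar>a y\<bar> \<le> B"
  shows "integrable M (\<lambda>y. a y *\<^sub>R f y)"
proof (rule Bochner_Integration.integrable_bound)
  show "integrable M (\<lambda>y. B * norm (f y))" using assms(1) by auto
  show "(\<lambda>y. a y *\<^sub>R f y) \<in> borel_measurable M" using assms by auto
  show "AE y in M. norm (a y *\<^sub>R f y) \<le> norm (B * norm (f y))"
  proof (rule AE_I2)
    fix y
    have "\<bar>a y\<bar> * norm (f y) \<le> B * norm (f y)" using assms(3) by (intro mult_right_mono) auto
    then show "norm (a y *\<^sub>R f y) \<le> norm (B * norm (f y))" by simp
  qed
qed

lemma norm_integral_scaleR_le:
  fixes f :: "'a \<Rightarrow> 'b::euclidean_space" and a :: "'a \<Rightarrow> real"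
  assumes "integrable M f" "a \<in> borel_measurable M" "\<And>y. \<bar>a y\<bar> \<le> B"
  shows "norm (LINT y|M. a y *\<^sub>R f y) \<le> B * (LINT y|M. norm (f y))"
proof -
  have "norm (LINT y|M. a y *\<^sub>R f y) \<le> (LINT y|M. norm (a y *\<^sub>R f y))"
    by (rule integral_norm_bound)
  also have "\<dots> \<le> (LINT y|M. B * norm (f y))"
  proof (rule integral_mono)
    show "integrable M (\<lambda>y. norm (a y *\<^sub>R f y))"
      by (rule integrable_norm[OF integrable_scaleR_bounded[OF assms]])
    show "integrable M (\<lambda>y. B * norm (f y))" using assms(1) by auto
    show "norm (a y *\<^sub>R f y) \<le> B * norm (f y)" for y
      using assms(3)[of y] by (simp add: mult_right_mono)
  qed
  finally show ?thesis by simp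
qed

lemma conv_integrable:
  fixes \<psi> :: "real^'n \<Rightarrow> real" and f :: "real^'n \<Rightarrow> 'b::euclidean_space"
  assumes "integrable lebesgue f" "continuous_on UNIV \<psi>" "\<And>z. norm z \<ge> R \<Longrightarrow> \<psi> z = 0"
  shows "integrable lebesgue (\<lambda>y. \<psi> (x - y) *\<^sub>R f y)"
proof -
  obtain B where "\<And>z. \<bar>\<psi> z\<bar> \<le> B" using compact_support_bounded[OF assms(2,3)] by blast
  then show ?thesis using assms(1,2) by (intro integrable_scaleR_bounded measurable_shift)
qed

lemma continuous_on_conv:
  fixes \<psi> :: "real^'n \<Rightarrow> real" and f :: "real^'n \<Rightarrow> 'b::euclidean_space"
  assumes f: "integrable lebesgue f" and c: "continuous_on UNIV \<psi>" and s: "\<And>z. norm z \<ge> R \<Longrightarrow> \<psi> z = 0"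
  shows "continuous_on UNIV (conv \<psi> f)"
  unfolding continuous_on_iff
proof (intro ballI allI impI)
  fix x :: "real^'n" and e :: real assume "e > 0"
  define C where "C = (LINT y|lebesgue. norm (f y))"
  have "C \<ge> 0" unfolding C_def by (rule integral_nonneg_AE) auto
  then have "e / (C + 1) > 0" using \<open>e > 0\<close> by auto
  obtain d where d: "d > 0" "\<And>z w. norm (w - z) < d \<Longrightarrow> norm (\<psi> w - \<psi> z) < e / (C + 1)"
    using compact_support_uniformly_continuous[OF c s \<open>e / (C + 1) > 0\<close>] by blast
  have "dist (conv \<psi> f x') (conv \<psi> f x) < e" if "dist x' x < d" for x'
  proof -
    have "\<bar>\<psi> (x' - y) - \<psi> (x - y)\<bar> < e / (C + 1)" for y
      using d(2)[of "x' - y" "x - y"] that by (simp add: dist_norm)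
    then have "norm (LINT y|lebesgue. (\<psi> (x' - y) - \<psi> (x - y)) *\<^sub>R f y) \<le> e / (C + 1) * C"
      unfolding C_def using f c by (intro norm_integral_scaleR_le borel_measurable_diff measurable_shift) (auto intro: less_imp_le)
    also have "\<dots> < e" using \<open>e > 0\<close> \<open>C \<ge> 0\<close> by (simp add: field_simps)
    also have "(LINT y|lebesgue. (\<psi> (x' - y) - \<psi> (x - y)) *\<^sub>R f y) = conv \<psi> f x' - conv \<psi> f x"
      unfolding conv_def scaleR_diff_left
      by (intro Bochner_Integration.integral_diff conv_integrable[OF f c s])
    finally show ?thesis by (simp add: dist_norm)
  qed
  with d(1) show "\<exists>d>0. \<forall>x'\<in>UNIV. dist x' x < d \<longrightarrow> dist (conv \<psi> f x') (conv \<psi> f x) < e" by auto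
qed

section \<open>Differentiation of convolutions\<close>

lemma frechet_derivative_eq_0:
  assumes "closed C" "\<And>y. y \<notin> C \<Longrightarrow> \<psi> y = 0" "x \<notin> C"
  shows "frechet_derivative \<psi> (at x) v = 0"
proof -
  have "((\<lambda>_. 0) has_derivative (\<lambda>_. 0)) (at x)" by simp
  then have "(\<psi> has_derivative (\<lambda>_. 0)) (at x)"
    by (rule has_derivative_transform_within_open[where s = "- C"]) (use assms in auto)
  then show ?thesis using frechet_derivative_at by metis
qed

text \<open>Vanishing passes to the derivative on the open exterior of the ball. The margin 1
  restores a condition of the original form, so the lemma can be iterated over higher
  derivatives.\<close>

lemma frechet_derivative_eq_0_outside:
  assumes "\<And>z::real^'n. norm z \<ge> R \<Longrightarrow> \<psi> z = (0::real)" "norm z \<ge> R + 1"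
  shows "frechet_derivative \<psi> (at z) v = 0"
  using assms by (intro frechet_derivative_eq_0[OF closed_cball[of 0 R]]) auto

text \<open>The partial derivatives are continuous with compact support, hence uniformly continuous,
  and the mean value inequality turns this into a remainder estimate uniform in \<open>z\<close>.
  Uniformity is what survives integration against a merely integrable function.\<close>

lemma Ck_uniformly_differentiable:
  fixes \<psi> :: "real^'n \<Rightarrow> real"
  assumes c: "Ck (Suc k) \<psi>" and s: "\<And>z. norm z \<ge> R \<Longrightarrow> \<psi> z = 0" and "e > 0"
  shows "\<exists>d>0. \<forall>z h. norm h < d \<longrightarrow>
    \<bar>\<psi> (z + h) - \<psi> z - frechet_derivative \<psi> (at z) h\<bar> \<le> e * norm h"
proof -
  let ?D = "\<lambda>z. frechet_derivative \<psi> (at z)"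
  \<comment> \<open>The errors of the partial derivatives are summed over all coordinates, each
    weighted by at most \<open>norm v\<close>.\<close>
  define e' where "e' = e / real CARD('n)"
  have "e' > 0" using \<open>e > 0\<close> by (simp add: e'_def)
  have "\<exists>d>0. \<forall>z w. norm (w - z) < d \<longrightarrow> \<bar>?D w (axis i 1) - ?D z (axis i 1)\<bar> < e'" for i
  proof -
    have "continuous_on UNIV (\<lambda>z. ?D z (axis i 1))" using c Ck_imp_continuous by auto
    moreover have "?D z (axis i 1) = 0" if "norm z \<ge> R + 1" for z
      by (rule frechet_derivative_eq_0_outside[OF s that])
    ultimately show ?thesis
      using compact_support_uniformly_continuous[of "\<lambda>z. ?D z (axis i 1)" "R + 1", OF _ _ \<open>e' > 0\<close>] by simp
  qed
  then obtain d where d: "\<And>i. d i > 0"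
    "\<And>i z w. norm (w - z) < d i \<Longrightarrow> \<bar>?D w (axis i 1) - ?D z (axis i 1)\<bar> < e'"
    by metis
  define d0 where "d0 = Min (range d)"
  have d0: "d0 > 0" "\<And>i. d0 \<le> d i" using d(1) by (auto simp: d0_def)
  have lin: "linear (?D z)" for z
    using Ck_Suc_has_derivative[OF c] has_derivative_linear by blast
  have diff: "\<bar>?D w v - ?D z v\<bar> \<le> e * norm v" if "norm (w - z) < d0" for w z v
  proof -
    have v: "v = (\<Sum>i\<in>UNIV. v $ i *\<^sub>R axis i 1)"
      by (simp add: vec_eq_iff axis_def if_distrib cong: if_cong)
    have "?D w v - ?D z v = (\<Sum>i\<in>UNIV. v $ i * (?D w (axis i 1) - ?D z (axis i 1)))"
      by (subst (1 2) v) (simp add: linear_sum[OF lin] linear_scale[OF lin] o_def sum_subtractf algebra_simps)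
    also have "\<bar>\<dots>\<bar> \<le> (\<Sum>i\<in>(UNIV::'n set). norm v * e')"
    proof (rule order_trans[OF sum_abs sum_mono])
      fix i :: 'n
      show "\<bar>v $ i * (?D w (axis i 1) - ?D z (axis i 1))\<bar> \<le> norm v * e'"
        unfolding abs_mult using d(2)[of w z i] d0(2)[of i] that component_le_norm_cart[of v i]
        by (intro mult_mono) auto
    qed
    also have "\<dots> = e * norm v" by (simp add: e'_def)
    finally show ?thesis .
  qed
  have "\<bar>\<psi> (z + h) - \<psi> z - ?D z h\<bar> \<le> e * norm h" if "norm h < d0" for z h
  proof -
    have "norm (\<psi> (z + h) - \<psi> z - ?D z ((z + h) - z)) \<le> norm ((z + h) - z) * e"
    proof (rule differentiable_bound_linearization)
      show "z + t *\<^sub>R (z + h - z) \<in> ball z d0" if "t \<in> {0..1}" for t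
      proof -
        have "\<bar>t\<bar> * norm h \<le> 1 * norm h" using that by (intro mult_right_mono) auto
        then show ?thesis using \<open>norm h < d0\<close> by (simp add: dist_norm)
      qed
      show "(\<psi> has_derivative ?D w) (at w within ball z d0)" for w
        using Ck_Suc_has_derivative[OF c] has_derivative_at_withinI by blast
      show "onorm (?D w - ?D z) \<le> e" if "w \<in> ball z d0" for w
        using diff[of w z] that by (intro onorm_le) (simp add: dist_norm norm_minus_commute)
      show "z \<in> ball z d0" using d0 by simp
    qed
    then show ?thesis by (simp add: mult.commute)
  qed
  with d0(1) show ?thesis by blast
qed

text \<open>The first-order remainder of the kernel is at most a small multiple of
  \<open>norm (y - x)\<close>, uniformly in the integration variable; integrating it against
  \<open>f\<close> costs only the L1 norm of \<open>f\<close>. No limit has to be taken under the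
  integral.\<close>

lemma conv_has_derivative:
  fixes \<psi> f :: "real^'n \<Rightarrow> real"
  assumes f: "integrable lebesgue f" and c: "Ck (Suc k) \<psi>" and s: "\<And>z. norm z \<ge> R \<Longrightarrow> \<psi> z = 0"
  shows "(conv \<psi> f has_derivative (\<lambda>v. conv (\<lambda>z. frechet_derivative \<psi> (at z) v) f x)) (at x)"
proof -
  let ?D = "\<lambda>z. frechet_derivative \<psi> (at z)"
  let ?L = "\<lambda>v. conv (\<lambda>z. ?D z v) f x"
  have cont: "continuous_on UNIV \<psi>" "\<And>v. continuous_on UNIV (\<lambda>z. ?D z v)"
    using c Ck_imp_continuous by (blast, auto)
  have lin: "linear (?D z)" for z
    using Ck_Suc_has_derivative[OF c] has_derivative_linear by blast
  have i0: "integrable lebesgue (\<lambda>y. \<psi> (x - y) *\<^sub>R f y)" for x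
    by (rule conv_integrable[OF f cont(1) s])
  have iD: "integrable lebesgue (\<lambda>y. ?D (x - y) v *\<^sub>R f y)" for v
    by (rule conv_integrable[OF f cont(2) frechet_derivative_eq_0_outside[OF s]])
  have "linear ?L"
    unfolding conv_def using iD
    by (intro linearI) (simp_all add: linear_add[OF lin] linear_scale[OF lin] distrib_right mult.assoc)
  then have bl: "bounded_linear ?L" by (simp add: linear_conv_bounded_linear)
  define C where "C = (LINT y|lebesgue. norm (f y))"
  have "C \<ge> 0" unfolding C_def by (rule integral_nonneg_AE) auto
  show ?thesis unfolding has_derivative_at_alt
  proof (intro conjI bl allI impI)
    fix e :: real assume "e > 0"
    then have e': "e / (C + 1) > 0" using \<open>C \<ge> 0\<close> by auto
    obtain d where d: "d > 0" "\<And>z h. norm h < d \<Longrightarrow> \<bar>\<psi> (z + h) - \<psi> z - ?D z h\<bar> \<le> e / (C + 1) * norm h"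
      using Ck_uniformly_differentiable[OF c s e'] by blast
    have "norm (conv \<psi> f y - conv \<psi> f x - ?L (y - x)) \<le> e * norm (y - x)" if "norm (y - x) < d" for y
    proof -
      have "norm (LINT t|lebesgue. (\<psi> (y - t) - \<psi> (x - t) - ?D (x - t) (y - x)) *\<^sub>R f t) \<le> (e / (C + 1) * norm (y - x)) * C"
        unfolding C_def
      proof (rule norm_integral_scaleR_le[OF f])
        show "(\<lambda>t. \<psi> (y - t) - \<psi> (x - t) - ?D (x - t) (y - x)) \<in> borel_measurable lebesgue"
          using cont by (intro borel_measurable_diff measurable_shift) auto
        show "\<bar>\<psi> (y - t) - \<psi> (x - t) - ?D (x - t) (y - x)\<bar> \<le> e / ((LINT y|lebesgue. norm (f y)) + 1) * norm (y - x)" for t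
          using d(2)[OF that, of "x - t"] by (simp add: C_def algebra_simps)
      qed
      also have "\<dots> = (e * norm (y - x)) * (C / (C + 1))" by simp
      also have "\<dots> \<le> (e * norm (y - x)) * 1"
        using \<open>C \<ge> 0\<close> \<open>e > 0\<close> by (intro mult_left_mono) auto
      also have "(LINT t|lebesgue. (\<psi> (y - t) - \<psi> (x - t) - ?D (x - t) (y - x)) *\<^sub>R f t)
          = conv \<psi> f y - conv \<psi> f x - ?L (y - x)"
        unfolding conv_def using i0 iD by (simp add: left_diff_distrib)
      finally show ?thesis by simp
    qed
    with d(1) show "\<exists>d>0. \<forall>y. norm (y - x) < d \<longrightarrow> norm (conv \<psi> f y - conv \<psi> f x - ?L (y - x)) \<le> e * norm (y - x)"
      by blast
  qed
qed

text \<open>Each differentiation falls on the kernel and enlarges the radius \<open>R\<close> of its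
  support by 1, so both are generalised in the induction.\<close>

lemma Ck_conv:
  fixes \<psi> f :: "real^'n \<Rightarrow> real"
  assumes f: "integrable lebesgue f"
  shows "Ck k \<psi> \<Longrightarrow> (\<And>z. norm z \<ge> R \<Longrightarrow> \<psi> z = 0) \<Longrightarrow> Ck k (conv \<psi> f)"
proof (induction k arbitrary: \<psi> R)
  case 0
  then show ?case using continuous_on_conv[OF f] by auto
next
  case (Suc k)
  show ?case
  proof (rule Ck_SucI[OF conv_has_derivative[OF f Suc.prems]])
    fix v
    show "Ck k (\<lambda>x. conv (\<lambda>z. frechet_derivative \<psi> (at z) v) f x)"
    proof (rule Suc.IH)
      show "Ck k (\<lambda>z. frechet_derivative \<psi> (at z) v)" using Suc.prems(1) by simp
      show "frechet_derivative \<psi> (at z) v = 0" if "norm z \<ge> R + 1" for z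
        by (rule frechet_derivative_eq_0_outside[OF Suc.prems(2) that])
    qed
  qed
qed

subsection \<open>Mollifiers\<close>

text \<open>Each radius is normalised by its own integral; the bound \<open>moll_le\<close> takes
  the place of the scaling law of a standard mollifier.\<close>

definition moll :: "real \<Rightarrow> real^'n \<Rightarrow> real" where
  "moll r z = bump r z / (LINT y|lborel. bump r (y :: real^'n))"

lemma continuous_on_bump: "continuous_on UNIV (bump r)"
  using Ck_imp_continuous[OF Ck_bump_shift[of _ r 0]] by simp

lemma integrable_bump:
  assumes "r > 0"
  shows "integrable lborel (bump r :: real^'n \<Rightarrow> real)"
proof -
  have "integrable lborel (\<lambda>x::real^'n. indicator (cball 0 r) x *\<^sub>R bump r x)"
    by (rule borel_integrable_compact[OF compact_cball continuous_on_subset[OF continuous_on_bump subset_UNIV]])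
  moreover have "(\<lambda>x::real^'n. indicator (cball 0 r) x *\<^sub>R bump r x) = bump r"
  proof (rule ext)
    fix x :: "real^'n"
    show "indicator (cball 0 r) x *\<^sub>R bump r x = bump r x"
      using bump_eq_0[OF assms, of x] by (cases "norm x \<le> r") auto
  qed
  ultimately show ?thesis by simp
qed

lemma integral_bump_ge:
  assumes "r > 0"
  shows "(LINT y|lborel. bump r (y :: real^'n)) \<ge>
    exp (- 2) * (unit_ball_vol (real CARD('n)) / 2 ^ CARD('n)) * r ^ CARD('n)"
proof -
  have "exp (- 2) * (unit_ball_vol (real CARD('n)) / 2 ^ CARD('n)) * r ^ CARD('n)
      = exp (- 2) * measure lborel (ball (0::real^'n) (r / 2))"
    using assms content_ball[of "r / 2" "0::real^'n"] by (simp add: power_divide)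
  also have "\<dots> = (LINT y|lborel. exp (- 2) * indicator (ball (0::real^'n) (r / 2)) y)"
    by simp
  also have "\<dots> \<le> (LINT y|lborel. bump r (y :: real^'n))"
  proof (rule integral_mono)
    show "integrable lborel (\<lambda>y::real^'n. exp (- 2 :: real) * indicator (ball (0::real^'n) (r / 2)) y)"
      using emeasure_lborel_ball_finite[of "0::real^'n" "r / 2"]
      by (intro integrable_mult_right) (simp add: integrable_real_indicator)
    show "exp (- 2) * indicator (ball 0 (r / 2)) y \<le> bump r y" for y :: "real^'n"
      using bump_ge[of y r] bump_nonneg[of r y] assms by (auto simp: indicator_def)
  qed (rule integrable_bump[OF assms])
  finally show ?thesis .
qed

lemma integral_bump_pos:
  assumes "r > 0"
  shows "(LINT y|lborel. bump r (y :: real^'n)) > 0"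
  by (rule less_le_trans[OF _ integral_bump_ge[OF assms]]) (use assms in simp)

lemma Ck_moll_shift: "Ck k (\<lambda>y. moll r (y - a))"
  using Ck_mult[OF Ck_bump_shift Ck_const[of k "inverse _"]]
  unfolding moll_def divide_inverse .

lemma Ck_moll: "Ck k (moll r)"
  using Ck_moll_shift[of k r 0] by simp

lemma moll_minus: "moll r (- z) = moll r z"
  by (simp add: moll_def bump_minus)

lemma moll_minus_commute: "moll r (x - y) = moll r (y - x)"
  using moll_minus[of r "y - x"] by simp

lemma continuous_on_moll: "continuous_on UNIV (moll r)"
  by (rule Ck_imp_continuous[OF Ck_moll])

lemma moll_nonneg: "moll r z \<ge> 0"
  unfolding moll_def by (intro divide_nonneg_nonneg integral_nonneg_AE) (auto simp: bump_nonneg)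

lemma moll_eq_0: "r > 0 \<Longrightarrow> norm z \<ge> r \<Longrightarrow> moll r z = 0"
  by (simp add: moll_def bump_eq_0)

text \<open>The constant is uniform in \<open>r\<close>. The power of \<open>r\<close> found here is
  the source of the exponent \<open>- N / p\<close> in \<open>norm_conv_moll_Lp_le\<close>.\<close>

lemma moll_le:
  obtains A where "A > 0" "\<And>r z. r > 0 \<Longrightarrow> moll r (z :: real^'n) \<le> A / r ^ CARD('n)"
proof
  let ?a = "exp (- 2) * (unit_ball_vol (real CARD('n)) / 2 ^ CARD('n))"
  have a: "?a > 0" by simp
  then show "1 / ?a > 0" by simp
  fix r :: real and z :: "real^'n" assume r: "r > 0"
  have "moll r z \<le> 1 / (?a * r ^ CARD('n))"
    unfolding moll_def using bump_le_1 integral_bump_ge[OF r, where 'n = 'n] a r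
    by (intro frac_le) auto
  then show "moll r z \<le> 1 / ?a / r ^ CARD('n)" by simp
qed

lemma measurable_shift_moll [measurable]:
  "(\<lambda>y. moll r (y - x)) \<in> borel_measurable lebesgue" "(\<lambda>y. moll r (x - y)) \<in> borel_measurable lebesgue"
proof -
  show "(\<lambda>y. moll r (x - y)) \<in> borel_measurable lebesgue"
    by (rule measurable_shift[OF continuous_on_moll])
  moreover have "(\<lambda>y. moll r (y - x)) = (\<lambda>y. moll r (x - y))"
    by (rule ext) (rule moll_minus_commute)
  ultimately show "(\<lambda>y. moll r (y - x)) \<in> borel_measurable lebesgue" by simp
qed

lemma nn_integral_moll:
  assumes "r > 0"
  shows "(\<integral>\<^sup>+y. ennreal (moll r (y - (x :: real^'n))) \<partial>lebesgue) = 1"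
    "(\<integral>\<^sup>+y. ennreal (moll r (x - y)) \<partial>lebesgue) = 1"
proof -
  have [measurable]: "moll r \<in> borel_measurable (borel :: (real^'n) measure)"
    by (intro borel_measurable_continuous_onI continuous_on_moll)
  have "(\<integral>\<^sup>+y. ennreal (moll r (y - x)) \<partial>lebesgue) = (\<integral>\<^sup>+y. ennreal (moll r (y - x)) \<partial>lborel)"
    by (rule nn_integral_completion) 
  also have "\<dots> = (\<integral>\<^sup>+y. ennreal (moll r (y - x)) \<partial>distr lborel borel ((+) x))"
    by (simp add: lborel_distr_plus)
  also have "\<dots> = (\<integral>\<^sup>+y. ennreal (moll r (y :: real^'n)) \<partial>lborel)"
    by (subst nn_integral_distr) auto
  also have "\<dots> = ennreal (LINT y|lborel. moll r (y :: real^'n))"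
    using integrable_bump[OF assms] moll_nonneg
    by (intro nn_integral_eq_integral) (auto simp: moll_def)
  also have "(LINT y|lborel. moll r (y :: real^'n)) = 1"
    using integral_bump_pos[OF assms, where 'n = 'n] by (simp add: moll_def)
  finally show "(\<integral>\<^sup>+y. ennreal (moll r (y - x)) \<partial>lebesgue) = 1" by simp
  then show "(\<integral>\<^sup>+y. ennreal (moll r (x - y)) \<partial>lebesgue) = 1"
    unfolding moll_minus_commute[where x = x and r = r] .
qed

text \<open>Tonelli is applied below to integrands that are only Lebesgue measurable. A countable
  cover by Borel sets of finite measure serves for the completion as well.\<close>

lemma sigma_finite_lebesgue: "sigma_finite_measure (lebesgue :: 'a::euclidean_space measure)"
proof
  obtain A :: "'a set set" where A: "countable A" "A \<subseteq> sets lborel" "\<Union>A = space lborel" "\<forall>a\<in>A. emeasure lborel a \<noteq> \<infinity>"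
    using lborel.sigma_finite_countable by blast
  have "a \<in> sets lebesgue \<and> emeasure lebesgue a \<noteq> \<infinity>" if "a \<in> A" for a
  proof -
    have "a \<in> sets lborel" "emeasure lborel a \<noteq> \<infinity>" using A that by auto
    then show ?thesis by (auto simp: emeasure_lborel_UNIV)
  qed
  with A(1,3) show "\<exists>A :: 'a set set. countable A \<and> A \<subseteq> sets lebesgue \<and> \<Union>A = space lebesgue \<and> (\<forall>a\<in>A. emeasure lebesgue a \<noteq> \<infinity>)"
    by (intro exI[of _ A] conjI ballI subsetI) (auto simp only: space_completion)
qed

lemma nn_integral_moll_Tonelli:
  fixes h :: "real^'n \<Rightarrow> real"
  assumes r: "r > 0" and [measurable]: "h \<in> borel_measurable lebesgue"
  shows "(\<integral>\<^sup>+x. \<integral>\<^sup>+y. ennreal (moll r (x - y) * h y) \<partial>lebesgue \<partial>lebesgue) = (\<integral>\<^sup>+y. ennreal (h y) \<partial>lebesgue)"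
proof -
  interpret L: sigma_finite_measure "lebesgue :: (real^'n) measure" by (rule sigma_finite_lebesgue)
  interpret P: pair_sigma_finite "lebesgue :: (real^'n) measure" "lebesgue :: (real^'n) measure" ..
  have [measurable]: "moll r \<in> borel_measurable (borel :: (real^'n) measure)"
    by (intro borel_measurable_continuous_onI continuous_on_moll)
  \<comment> \<open>The kernel is Borel in the difference of the two variables; through this map its
    composition becomes measurable for the product of the completed spaces.\<close>
  have id: "(\<lambda>x. x) \<in> lebesgue \<rightarrow>\<^sub>M (borel :: (real^'n) measure)"
    by (intro measurable_completion) simp
  have [measurable]: "fst \<in> lebesgue \<Otimes>\<^sub>M lebesgue \<rightarrow>\<^sub>M (borel :: (real^'n) measure)"
     "snd \<in> lebesgue \<Otimes>\<^sub>M lebesgue \<rightarrow>\<^sub>M (borel :: (real^'n) measure)"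
    by (rule measurable_compose[OF measurable_fst id], rule measurable_compose[OF measurable_snd id])
  have [measurable]: "(\<lambda>z. h (snd z)) \<in> borel_measurable (lebesgue \<Otimes>\<^sub>M lebesgue)"
    by (rule measurable_compose[OF measurable_snd]) fact
  have m: "(\<lambda>z. ennreal (moll r (fst z - snd z) * h (snd z))) \<in> borel_measurable (lebesgue \<Otimes>\<^sub>M lebesgue)"
    by measurable
  have "(\<integral>\<^sup>+x. \<integral>\<^sup>+y. ennreal (moll r (x - y) * h y) \<partial>lebesgue \<partial>lebesgue)
      = (\<integral>\<^sup>+y. \<integral>\<^sup>+x. ennreal (moll r (x - y) * h y) \<partial>lebesgue \<partial>lebesgue)"
    using P.Fubini'[of "\<lambda>x y. ennreal (moll r (x - y) * h y)"] m by (simp add: case_prod_beta')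
  also have "\<dots> = (\<integral>\<^sup>+y. ennreal (h y) * (\<integral>\<^sup>+x. ennreal (moll r (x - y)) \<partial>lebesgue) \<partial>lebesgue)"
    by (intro nn_integral_cong)
       (simp add: ennreal_mult'' moll_nonneg mult.commute[of _ "h _"] flip: nn_integral_cmult)
  finally show ?thesis by (simp add: nn_integral_moll[OF r])
qed

lemma integrable_moll:
  assumes "r > 0" "integrable lebesgue (f :: real^'n \<Rightarrow> 'b::euclidean_space)"
  shows "integrable lebesgue (\<lambda>y. moll r (x - y) *\<^sub>R f y)"
  by (rule conv_integrable[OF assms(2) continuous_on_moll moll_eq_0[OF assms(1)]])

lemma measurable_conv_moll [measurable]:
  assumes "r > 0" "integrable lebesgue (f :: real^'n \<Rightarrow> 'b::euclidean_space)"
  shows "conv (moll r) f \<in> borel_measurable lebesgue"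
proof -
  have "conv (moll r) f \<in> borel_measurable borel"
    by (rule borel_measurable_continuous_onI)
       (rule continuous_on_conv[OF assms(2) continuous_on_moll moll_eq_0[OF assms(1)]])
  then show ?thesis by (intro measurable_completion) simp
qed

lemma norm_conv_moll_le:
  assumes "r > 0" "integrable lebesgue (f :: real^'n \<Rightarrow> 'b::euclidean_space)"
  shows "ennreal (norm (conv (moll r) f x)) \<le> (\<integral>\<^sup>+y. ennreal (moll r (x - y) * norm (f y)) \<partial>lebesgue)"
  using integral_norm_bound_ennreal[OF integrable_moll[OF assms, of x]]
  by (simp add: conv_def moll_nonneg)

lemma nn_integral_norm_conv_moll_le:
  assumes "r > 0" "integrable lebesgue (f :: real^'n \<Rightarrow> 'b::euclidean_space)"
  shows "(\<integral>\<^sup>+x. ennreal (norm (conv (moll r) f x)) \<partial>lebesgue) \<le> (\<integral>\<^sup>+x. ennreal (norm (f x)) \<partial>lebesgue)"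
proof -
  have "(\<integral>\<^sup>+x. ennreal (norm (conv (moll r) f x)) \<partial>lebesgue)
      \<le> (\<integral>\<^sup>+x. \<integral>\<^sup>+y. ennreal (moll r (x - y) * norm (f y)) \<partial>lebesgue \<partial>lebesgue)"
    by (intro nn_integral_mono norm_conv_moll_le[OF assms])
  also have "\<dots> = (\<integral>\<^sup>+x. ennreal (norm (f x)) \<partial>lebesgue)"
    using assms(2) by (intro nn_integral_moll_Tonelli[OF assms(1)]) auto
  finally show ?thesis .
qed

lemma conv_diff:
  assumes "r > 0" "integrable lebesgue (f :: real^'n \<Rightarrow> 'b::euclidean_space)" "integrable lebesgue g"
  shows "conv (moll r) (\<lambda>y. f y - g y) x = conv (moll r) f x - conv (moll r) g x"
  unfolding conv_def scaleR_diff_right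
  by (intro Bochner_Integration.integral_diff integrable_moll[OF assms(1)] assms)

lemma integral_moll:
  assumes "r > 0"
  shows "(LINT y|lebesgue. moll r (x - y)) = 1" "integrable lebesgue (\<lambda>y. moll r (x - y))"
proof -
  show "integrable lebesgue (\<lambda>y. moll r (x - y))"
    using nn_integral_moll(2)[OF assms, of x] by (intro integrableI_bounded) (auto simp: moll_nonneg)
  then show "(LINT y|lebesgue. moll r (x - y)) = 1"
    using nn_integral_moll(2)[OF assms, of x] nn_integral_eq_integral[of lebesgue "\<lambda>y. moll r (x - y)"]
    by (simp add: moll_nonneg ennreal_eq_1)
qed

subsection \<open>Convergence of mollifications in \<open>L\<^sup>1\<close>\<close>

lemma tendsto_0_ennrealI:
  fixes f :: "'a \<Rightarrow> ennreal"
  assumes "\<And>e::real. e > 0 \<Longrightarrow> eventually (\<lambda>x. f x \<le> ennreal e) F"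
  shows "(f \<longlongrightarrow> 0) F"
proof (rule order_tendstoI)
  fix a :: ennreal assume "0 < a"
  then obtain b where b: "0 < b" "b < a" using dense by blast
  then obtain e where e: "b = ennreal e" "e \<ge> 0"
    using le_less_trans[OF order_refl, of b a] by (cases b) auto
  with b have "e > 0" by (auto simp: less_le)
  from assms[OF this] show "eventually (\<lambda>x. f x < a) F"
    by eventually_elim (use b e in auto)
qed simp

text \<open>Projection onto a ball truncates vector-valued functions continuously. The second bound
  makes the function itself a majorant of the truncation error.\<close>

lemma closest_point_0_cball:
  fixes v :: "'b::euclidean_space"
  assumes "B \<ge> 0"
  shows "norm (closest_point (cball 0 B) v) \<le> B" "norm (v - closest_point (cball 0 B) v) \<le> norm v"
    "norm v \<le> B \<Longrightarrow> closest_point (cball 0 B) v = v"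
    "continuous_on UNIV (closest_point (cball (0::'b) B))"
proof -
  have "closest_point (cball 0 B) v \<in> cball 0 B"
    using assms by (intro closest_point_in_set) auto
  then show "norm (closest_point (cball 0 B) v) \<le> B" by simp
  show "norm (v - closest_point (cball 0 B) v) \<le> norm v"
    using closest_point_le[of "cball 0 B" 0 v] assms by (simp add: dist_norm)
  show "norm v \<le> B \<Longrightarrow> closest_point (cball 0 B) v = v"
    by (intro closest_point_self) simp
  show "continuous_on UNIV (closest_point (cball (0::'b) B))"
    using assms by (intro continuous_on_closest_point) auto
qed

lemma nn_integral_const_cball:
  assumes "c \<ge> 0"
  shows "(\<integral>\<^sup>+x. ennreal (c * indicator (cball (a :: 'a::euclidean_space) R) x) \<partial>lebesgue)
    = ennreal (c * measure lebesgue (cball a R))"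
proof -
  have "integrable lebesgue (\<lambda>x. c * indicator (cball a R) x :: real)"
    using emeasure_compact_finite[of "cball a R"]
    by (intro integrable_mult_right integrable_real_indicator) auto
  then show ?thesis using assms by (subst nn_integral_eq_integral) auto
qed

text \<open>A measurable function is almost everywhere a limit of continuous functions, but these
  have no common majorant. So \<open>f\<close> is first truncated at a height \<open>B\<close>; then
  the continuous approximants are projected onto the same ball and cut off outside a larger one,
  which supplies a bounded majorant of compact support.\<close>

lemma L1_approx_compact_support:
  fixes f :: "real^'n \<Rightarrow> 'b::euclidean_space"
  assumes f: "integrable lebesgue f" and supp: "\<And>y. norm y \<ge> R \<Longrightarrow> f y = 0" and "e > 0"
  shows "\<exists>g R'. continuous_on UNIV g \<and> (\<forall>y. norm y \<ge> R' \<longrightarrow> g y = 0) \<and>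
    (\<integral>\<^sup>+y. ennreal (norm (f y - g y)) \<partial>lebesgue) \<le> ennreal e"
proof -
  let ?c = "\<lambda>B. closest_point (cball (0::'b) B)"
  have [measurable]: "f \<in> borel_measurable lebesgue" using f by auto
  have cm [measurable]: "?c B \<in> borel_measurable borel" if "B \<ge> 0" for B
    using closest_point_0_cball(4)[OF that] by (rule borel_measurable_continuous_onI)
  have "(\<lambda>n. \<integral>\<^sup>+y. ennreal (norm (f y - ?c (real n) (f y))) \<partial>lebesgue) \<longlonglongrightarrow> (\<integral>\<^sup>+y. 0 \<partial>(lebesgue :: (real^'n) measure))"
  proof (rule nn_integral_dominated_convergence)
    show "(\<integral>\<^sup>+y. ennreal (norm (f y)) \<partial>lebesgue) < \<infinity>" using f by (auto simp: integrable_iff_bounded)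
    show "AE y in lebesgue. ennreal (norm (f y - ?c (real n) (f y))) \<le> ennreal (norm (f y))" for n
      using closest_point_0_cball(2)[of "real n"] by (auto intro!: ennreal_leI)
    show "AE y in lebesgue. (\<lambda>n. ennreal (norm (f y - ?c (real n) (f y)))) \<longlonglongrightarrow> 0"
    proof (rule AE_I2)
      fix y
      obtain k :: nat where k: "norm (f y) \<le> real k" using real_arch_simple by blast
      have "eventually (\<lambda>n. ennreal (norm (f y - ?c (real n) (f y))) = 0) sequentially"
        using eventually_ge_at_top[of k]
      proof eventually_elim
        case (elim n)
        with k have "norm (f y) \<le> real n" by linarith
        from closest_point_0_cball(3)[OF _ this] show ?case by simp
      qed
      then show "(\<lambda>n. ennreal (norm (f y - ?c (real n) (f y)))) \<longlonglongrightarrow> 0"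
        by (rule tendsto_eventually)
    qed
    show "(\<lambda>y. ennreal (norm (f y - ?c (real n) (f y)))) \<in> borel_measurable lebesgue" for n
      using cm[of "real n"] by measurable
  qed auto
  then have "eventually (\<lambda>n. (\<integral>\<^sup>+y. ennreal (norm (f y - ?c (real n) (f y))) \<partial>lebesgue) < ennreal (e / 2)) sequentially"
    using \<open>e > 0\<close> by (intro order_tendstoD) auto
  then obtain n where n: "(\<integral>\<^sup>+y. ennreal (norm (f y - ?c (real n) (f y))) \<partial>lebesgue) < ennreal (e / 2)"
    using eventually_happens trivial_limit_sequentially by blast
  define B where "B = real n"
  have B: "B \<ge> 0" by (simp add: B_def)
  have [measurable]: "?c B \<in> borel_measurable borel" by (rule cm[OF B])
  have c0: "?c B 0 = 0" using closest_point_0_cball(3)[OF B, of 0] B by simp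
  have "f measurable_on UNIV"
    using f by (intro lebesgue_measurable_imp_measurable_on) auto
  then obtain N g where N: "negligible N" and g: "\<And>n. continuous_on UNIV (g n)"
    and lim: "\<And>x. x \<notin> N \<Longrightarrow> (\<lambda>n. g n x) \<longlonglongrightarrow> f x"
    unfolding measurable_on_def by auto
  define cut where "cut y = max 0 (min 1 (\<bar>R\<bar> + 1 - norm y))" for y :: "real^'n"
  define h where "h n y = cut y *\<^sub>R ?c B (g n y)" for n y
  have cut: "0 \<le> cut y" "cut y \<le> 1" for y by (auto simp: cut_def)
  have ch: "continuous_on UNIV (h n)" for n
    unfolding h_def cut_def
    by (intro continuous_intros continuous_on_compose2[OF closest_point_0_cball(4)[OF B] g]) auto
  have [measurable]: "h n \<in> borel_measurable lebesgue" for n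
    using borel_measurable_continuous_onI[OF ch[of n]] by (intro measurable_completion) simp
  have hb: "norm (?c B (f y) - h n y) \<le> 2 * B * indicator (cball 0 (\<bar>R\<bar> + 1)) y" for n y
  proof (cases "norm y \<le> \<bar>R\<bar> + 1")
    case True
    have "norm (h n y) \<le> 1 * B"
      unfolding h_def norm_scaleR using cut[of y] closest_point_0_cball(1)[OF B, of "g n y"] B
      by (intro mult_mono) auto
    then have "norm (?c B (f y) - h n y) \<le> B + B"
      using norm_triangle_ineq4[of "?c B (f y)" "h n y"] closest_point_0_cball(1)[OF B, of "f y"] by linarith
    then show ?thesis using True by simp
  next
    case False
    then have "f y = 0" "cut y = 0" using supp[of y] by (auto simp: cut_def)
    then show ?thesis using B by (simp add: h_def c0)
  qed
  have "(\<lambda>n. \<integral>\<^sup>+y. ennreal (norm (?c B (f y) - h n y)) \<partial>lebesgue) \<longlonglongrightarrow> (\<integral>\<^sup>+y. 0 \<partial>(lebesgue :: (real^'n) measure))"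
  proof (rule nn_integral_dominated_convergence)
    show "(\<integral>\<^sup>+y. ennreal (2 * B * indicator (cball (0::real^'n) (\<bar>R\<bar> + 1)) y) \<partial>lebesgue) < \<infinity>"
      using B by (subst nn_integral_const_cball) auto
    have "cball (0::real^'n) (\<bar>R\<bar> + 1) \<in> sets lebesgue" by auto
    then show "(\<lambda>y. ennreal (2 * B * indicator (cball (0::real^'n) (\<bar>R\<bar> + 1)) y)) \<in> borel_measurable lebesgue"
      by measurable
    show "AE y in lebesgue. ennreal (norm (?c B (f y) - h n y)) \<le> ennreal (2 * B * indicator (cball 0 (\<bar>R\<bar> + 1)) y)" for n
      using hb by (auto intro!: ennreal_leI)
    have "N \<in> null_sets lebesgue" using N by (simp add: negligible_iff_null_sets)
    then have "AE y in lebesgue. y \<notin> N" by (rule AE_not_in)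
    then show "AE y in lebesgue. (\<lambda>n. ennreal (norm (?c B (f y) - h n y))) \<longlonglongrightarrow> 0"
    proof eventually_elim
      case (elim y)
      have "isCont (?c B) (f y)"
        using closest_point_0_cball(4)[OF B, where 'b = 'b] by (simp add: continuous_on_eq_continuous_at)
      then have "(\<lambda>n. ?c B (g n y)) \<longlonglongrightarrow> ?c B (f y)"
        using lim[OF elim] by (rule isCont_tendsto_compose)
      then have "(\<lambda>n. norm (?c B (f y) - h n y)) \<longlonglongrightarrow> norm (?c B (f y) - cut y *\<^sub>R ?c B (f y))"
        unfolding h_def by (intro tendsto_intros)
      \<comment> \<open>Where \<open>f\<close> vanishes both sides are 0, because the projection
        fixes 0; elsewhere \<open>norm y < R\<close> and the cut-off equals 1.\<close>
      also have "cut y *\<^sub>R ?c B (f y) = ?c B (f y)"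
        using supp[of y] c0 by (cases "norm y \<ge> R") (auto simp: cut_def)
      finally show ?case using tendsto_ennrealI by fastforce
    qed
  qed auto
  then have "eventually (\<lambda>n. (\<integral>\<^sup>+y. ennreal (norm (?c B (f y) - h n y)) \<partial>lebesgue) < ennreal (e / 2)) sequentially"
    using \<open>e > 0\<close> by (intro order_tendstoD) auto
  then obtain m where m: "(\<integral>\<^sup>+y. ennreal (norm (?c B (f y) - h m y)) \<partial>lebesgue) < ennreal (e / 2)"
    using eventually_happens trivial_limit_sequentially by blast
  have "(\<integral>\<^sup>+y. ennreal (norm (f y - h m y)) \<partial>lebesgue)
      \<le> (\<integral>\<^sup>+y. ennreal (norm (f y - ?c B (f y))) + ennreal (norm (?c B (f y) - h m y)) \<partial>lebesgue)"
  proof (rule nn_integral_mono)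
    fix y
    show "ennreal (norm (f y - h m y)) \<le> ennreal (norm (f y - ?c B (f y))) + ennreal (norm (?c B (f y) - h m y))"
      using norm_triangle_ineq[of "f y - ?c B (f y)" "?c B (f y) - h m y"]
      by (simp add: ennreal_leI flip: ennreal_plus)
  qed
  also have "\<dots> = (\<integral>\<^sup>+y. ennreal (norm (f y - ?c B (f y))) \<partial>lebesgue) + (\<integral>\<^sup>+y. ennreal (norm (?c B (f y) - h m y)) \<partial>lebesgue)"
    by (rule nn_integral_add) auto
  also have "\<dots> \<le> ennreal (e / 2) + ennreal (e / 2)"
    using n m by (intro add_mono) (auto simp: B_def)
  also have "\<dots> = ennreal e" using \<open>e > 0\<close> by (simp flip: ennreal_plus)
  finally have "(\<integral>\<^sup>+y. ennreal (norm (f y - h m y)) \<partial>lebesgue) \<le> ennreal e" .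
  moreover have "h m y = 0" if "norm y \<ge> \<bar>R\<bar> + 1" for y using that by (simp add: h_def cut_def)
  ultimately show ?thesis using ch by blast
qed

text \<open>The kernel has mass 1, so the difference is an average of \<open>f y - f x\<close> over
  the ball of radius \<open>r\<close>.\<close>

lemma norm_conv_moll_diff_le:
  fixes f :: "real^'n \<Rightarrow> 'b::euclidean_space"
  assumes r: "r > 0" and f: "integrable lebesgue f" and le: "\<And>y. norm (x - y) < r \<Longrightarrow> norm (f y - f x) \<le> e"
  shows "norm (conv (moll r) f x - f x) \<le> e"
proof -
  have i: "integrable lebesgue (\<lambda>y. moll r (x - y) *\<^sub>R f x)"
    by (rule integrable_scaleR_left) (rule integral_moll(2)[OF r])
  have i2: "integrable lebesgue (\<lambda>y. moll r (x - y) *\<^sub>R (f y - f x))"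
    unfolding scaleR_diff_right by (intro Bochner_Integration.integrable_diff integrable_moll[OF r f] i)
  have "conv (moll r) f x - f x = conv (moll r) f x - (LINT y|lebesgue. moll r (x - y) *\<^sub>R f x)"
    using Bochner_Integration.integral_scaleR_left[of "f x" lebesgue "\<lambda>y. moll r (x - y)"] integral_moll[OF r, of x]
    by simp
  also have "\<dots> = (LINT y|lebesgue. moll r (x - y) *\<^sub>R (f y - f x))"
    unfolding conv_def scaleR_diff_right
    by (intro Bochner_Integration.integral_diff[symmetric] integrable_moll[OF r f] i)
  also have "norm \<dots> \<le> (LINT y|lebesgue. norm (moll r (x - y) *\<^sub>R (f y - f x)))"
    by (rule integral_norm_bound)
  also have "\<dots> \<le> (LINT y|lebesgue. moll r (x - y) * e)"
  proof (rule integral_mono)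
    show "integrable lebesgue (\<lambda>y. norm (moll r (x - y) *\<^sub>R (f y - f x)))" by (rule integrable_norm[OF i2])
    show "integrable lebesgue (\<lambda>y. moll r (x - y) * e)" using integral_moll(2)[OF r, of x] by simp
    show "norm (moll r (x - y) *\<^sub>R (f y - f x)) \<le> moll r (x - y) * e" for y
      using le[of y] moll_nonneg[of r "x - y"] moll_eq_0[OF r, of "x - y"]
      by (cases "norm (x - y) < r") (auto intro: mult_left_mono)
  qed
  also have "\<dots> = e" using integral_moll[OF r, of x] by simp
  finally show ?thesis .
qed

lemma integrable_continuous_compact_support:
  fixes g :: "real^'n \<Rightarrow> 'b::euclidean_space"
  assumes "continuous_on UNIV g" "\<And>y. norm y \<ge> R \<Longrightarrow> g y = 0"
  shows "integrable lebesgue g"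
proof -
  have "integrable lborel (\<lambda>x. indicator (cball 0 R) x *\<^sub>R g x)"
    by (rule borel_integrable_compact[OF compact_cball continuous_on_subset[OF assms(1) subset_UNIV]])
  moreover have "(\<lambda>x. indicator (cball 0 R) x *\<^sub>R g x) = g"
    using assms(2) by (fastforce simp: indicator_def fun_eq_iff)
  ultimately have "integrable lborel g" by simp
  then show ?thesis by (subst integrable_completion) (auto intro!: borel_measurable_continuous_onI assms(1))
qed

lemma conv_moll_eq_0:
  assumes "r > 0" "\<And>y. norm (x - y) < r \<Longrightarrow> f y = 0"
  shows "conv (moll r) f x = 0"
proof -
  have "moll r (x - y) *\<^sub>R f y = 0" for y
    using assms(2)[of y] moll_eq_0[OF assms(1), of "x - y"] by (cases "norm (x - y) < r") auto
  then show ?thesis unfolding conv_def by (simp only: integral_zero)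
qed

text \<open>For a continuous \<open>g\<close> of compact support the mollifications converge
  uniformly and live on one fixed ball. The general case follows by density, since mollifying does
  not increase the L1 norm.\<close>

lemma conv_moll_L1:
  fixes f :: "real^'n \<Rightarrow> 'b::euclidean_space"
  assumes f: "integrable lebesgue f" and supp: "\<And>y. norm y \<ge> R \<Longrightarrow> f y = 0"
  shows "((\<lambda>r. \<integral>\<^sup>+x. ennreal (norm (conv (moll r) f x - f x)) \<partial>lebesgue) \<longlongrightarrow> 0) (at_right 0)"
proof (rule tendsto_0_ennrealI)
  fix e :: real assume "e > 0"
  then have e3: "e / 3 > 0" by simp
  from L1_approx_compact_support[OF f supp this]
  obtain g R' where g: "continuous_on UNIV g" and gs: "\<And>y. norm y \<ge> R' \<Longrightarrow> g y = 0"
    and fg: "(\<integral>\<^sup>+y. ennreal (norm (f y - g y)) \<partial>lebesgue) \<le> ennreal (e / 3)" by blast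
  have gi: "integrable lebesgue g" by (rule integrable_continuous_compact_support[OF g gs])
  \<comment> \<open>The margin 1 accommodates the supports of all mollifications with
    \<open>r < 1\<close>.\<close>
  let ?C = "cball (0::real^'n) (\<bar>R'\<bar> + 1)"
  define \<eta> where "\<eta> = e / 3 / (measure lebesgue ?C + 1)"
  have \<eta>: "\<eta> > 0" unfolding \<eta>_def using \<open>e > 0\<close> by (intro divide_pos_pos) (auto intro: add_nonneg_pos)
  have \<eta>C: "\<eta> * measure lebesgue ?C \<le> e / 3"
    unfolding \<eta>_def using \<open>e > 0\<close> measure_nonneg[of lebesgue ?C]
    by (simp add: field_simps add_nonneg_pos)
  obtain d where d: "d > 0" "\<And>z w. norm (w - z) < d \<Longrightarrow> norm (g w - g z) < \<eta>"
    using compact_support_uniformly_continuous[OF g gs \<eta>] by blast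
  have "eventually (\<lambda>r::real. r \<in> {0<..<min d 1}) (at_right 0)"
    using d(1) by (intro eventually_at_right_real) simp
  then show "eventually (\<lambda>r. (\<integral>\<^sup>+x. ennreal (norm (conv (moll r) f x - f x)) \<partial>lebesgue) \<le> ennreal e) (at_right 0)"
  proof eventually_elim
    case (elim r)
    then have r: "r > 0" "r < d" "r < 1" by auto
    have [measurable]: "conv (moll r) f \<in> borel_measurable lebesgue" "conv (moll r) g \<in> borel_measurable lebesgue"
      "f \<in> borel_measurable lebesgue" "g \<in> borel_measurable lebesgue"
      using r f gi by auto
    have bound: "norm (conv (moll r) g x - g x) \<le> \<eta> * indicator ?C x" for x
    proof (cases "x \<in> ?C")
      case True
      have "norm (conv (moll r) g x - g x) \<le> \<eta>"
      proof (rule norm_conv_moll_diff_le[OF r(1) gi])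
        fix y assume "norm (x - y) < r"
        then have "norm (y - x) < d" using r by (simp add: norm_minus_commute)
        then show "norm (g y - g x) \<le> \<eta>" using d(2) by (simp add: less_imp_le)
      qed
      with True show ?thesis by simp
    next
      case False
      have "conv (moll r) g x = 0"
      proof (rule conv_moll_eq_0[OF r(1)])
        fix y assume "norm (x - y) < r"
        moreover have "norm x \<le> norm y + norm (x - y)" using norm_triangle_ineq2[of x y] by linarith
        ultimately show "g y = 0" using False r by (intro gs) auto
      qed
      moreover have "g x = 0" using False by (intro gs) auto
      ultimately show ?thesis using False by simp
    qed
    have "(\<integral>\<^sup>+x. ennreal (norm (conv (moll r) g x - g x)) \<partial>lebesgue) \<le> (\<integral>\<^sup>+x. ennreal (\<eta> * indicator ?C x) \<partial>lebesgue)"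
      using bound by (intro nn_integral_mono ennreal_leI)
    also have "\<dots> = ennreal (\<eta> * measure lebesgue ?C)"
      using \<eta> by (intro nn_integral_const_cball) simp
    also have "\<dots> \<le> ennreal (e / 3)" using \<eta>C by (rule ennreal_leI)
    finally have 2: "(\<integral>\<^sup>+x. ennreal (norm (conv (moll r) g x - g x)) \<partial>lebesgue) \<le> ennreal (e / 3)" .
    have "(\<integral>\<^sup>+x. ennreal (norm (conv (moll r) (\<lambda>y. f y - g y) x)) \<partial>lebesgue) \<le> (\<integral>\<^sup>+x. ennreal (norm (f x - g x)) \<partial>lebesgue)"
      by (rule nn_integral_norm_conv_moll_le[OF r(1)]) (use f gi in auto)
    then have 1: "(\<integral>\<^sup>+x. ennreal (norm (conv (moll r) f x - conv (moll r) g x)) \<partial>lebesgue) \<le> ennreal (e / 3)"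
      using fg by (simp add: conv_diff[OF r(1) f gi])
    have "(\<integral>\<^sup>+x. ennreal (norm (conv (moll r) f x - f x)) \<partial>lebesgue)
      \<le> (\<integral>\<^sup>+x. ennreal (norm (conv (moll r) f x - conv (moll r) g x)) + ennreal (norm (conv (moll r) g x - g x))
           + ennreal (norm (f x - g x)) \<partial>lebesgue)"
    proof (rule nn_integral_mono)
      fix x
      have "norm (conv (moll r) f x - f x) = norm ((conv (moll r) f x - conv (moll r) g x) + (conv (moll r) g x - g x) - (f x - g x))"
        by simp
      also have "\<dots> \<le> norm (conv (moll r) f x - conv (moll r) g x) + norm (conv (moll r) g x - g x) + norm (f x - g x)"
        by (rule order_trans[OF norm_triangle_ineq4 add_right_mono[OF norm_triangle_ineq]])
      finally show "ennreal (norm (conv (moll r) f x - f x)) \<le> ennreal (norm (conv (moll r) f x - conv (moll r) g x))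
          + ennreal (norm (conv (moll r) g x - g x)) + ennreal (norm (f x - g x))"
        by (simp add: ennreal_leI flip: ennreal_plus)
    qed
    also have "\<dots> = (\<integral>\<^sup>+x. ennreal (norm (conv (moll r) f x - conv (moll r) g x)) \<partial>lebesgue)
        + (\<integral>\<^sup>+x. ennreal (norm (conv (moll r) g x - g x)) \<partial>lebesgue) + (\<integral>\<^sup>+x. ennreal (norm (f x - g x)) \<partial>lebesgue)"
      by (simp add: nn_integral_add)
    also have "\<dots> \<le> ennreal (e / 3) + ennreal (e / 3) + ennreal (e / 3)"
      by (intro add_mono 1 2 fg)
    also have "\<dots> = ennreal e" using \<open>e > 0\<close> by (simp flip: ennreal_plus)
    finally show ?case .
  qed
qed

subsection \<open>The fundamental lemma of the calculus of variations\<close>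

lemma C0_infD:
  assumes "\<psi> \<in> C0_inf U"
  shows "Ck k \<psi>" "\<exists>C. compact C \<and> C \<subseteq> U \<and> (\<forall>x. x \<notin> C \<longrightarrow> \<psi> x = 0)"
    "\<exists>R. \<forall>x. norm x \<ge> R \<longrightarrow> \<psi> x = 0"
proof -
  let ?C = "closure {x. \<psi> x \<noteq> 0}"
  have C: "compact ?C" "?C \<subseteq> U" using assms by (auto simp: C0_inf_def compactly_contained_def)
  show "Ck k \<psi>" using assms by (simp add: C0_inf_def)
  have out: "\<psi> x = 0" if "x \<notin> ?C" for x
    using that closure_subset[of "{x. \<psi> x \<noteq> 0}"] by blast
  with C show "\<exists>C. compact C \<and> C \<subseteq> U \<and> (\<forall>x. x \<notin> C \<longrightarrow> \<psi> x = 0)" by blast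
  obtain B where B: "\<And>x. x \<in> ?C \<Longrightarrow> norm x \<le> B"
    using compact_imp_bounded[OF C(1)] unfolding bounded_iff by blast
  have "\<psi> x = 0" if "norm x \<ge> B + 1" for x
    using B[of x] out[of x] that by force
  then show "\<exists>R. \<forall>x. norm x \<ge> R \<longrightarrow> \<psi> x = 0" by blast
qed

lemma C0_infI:
  assumes "\<And>k. Ck k \<psi>" "compact C" "C \<subseteq> U" "\<And>x. x \<notin> C \<Longrightarrow> \<psi> x = 0"
  shows "\<psi> \<in> C0_inf U"
proof -
  have "{x. \<psi> x \<noteq> 0} \<subseteq> C" using assms(4) by auto
  then have "closure {x. \<psi> x \<noteq> 0} \<subseteq> C" by (rule closure_minimal[OF _ compact_imp_closed[OF assms(2)]])
  then have "compactly_contained {x. \<psi> x \<noteq> 0} U"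
    using assms(2,3) bounded_subset[OF compact_imp_bounded[OF assms(2)] \<open>{x. \<psi> x \<noteq> 0} \<subseteq> C\<close>]
    by (auto simp: compactly_contained_def compact_closure)
  with assms(1) show ?thesis by (simp add: C0_inf_def)
qed

lemma C0_inf_mono: "\<psi> \<in> C0_inf U \<Longrightarrow> U \<subseteq> V \<Longrightarrow> \<psi> \<in> C0_inf V"
  by (auto simp: C0_inf_def compactly_contained_def)

lemma moll_shift_C0_inf:
  assumes "r > 0" "cball x r \<subseteq> U"
  shows "(\<lambda>y. moll r (y - x)) \<in> C0_inf U"
  using assms by (intro C0_infI[of _ "cball x r"] Ck_moll_shift moll_eq_0)
    (auto simp: dist_norm norm_minus_commute)

lemma integrable_test:
  fixes f :: "real^'n \<Rightarrow> real"
  assumes loc: "\<And>C. compact C \<Longrightarrow> C \<subseteq> U \<Longrightarrow> set_integrable lebesgue C f"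
    and \<psi>: "continuous_on UNIV \<psi>" "compact C" "C \<subseteq> U" "\<And>x. x \<notin> C \<Longrightarrow> \<psi> x = 0"
  shows "set_integrable lebesgue U (\<lambda>x. f x * \<psi> x)"
proof -
  obtain B where B: "\<And>x. x \<in> C \<Longrightarrow> norm x \<le> B"
    using compact_imp_bounded[OF \<psi>(2)] unfolding bounded_iff by blast
  have "\<psi> x = 0" if "norm x \<ge> B + 1" for x using B[of x] \<psi>(4)[of x] that by force
  then obtain b where b: "\<And>x. \<bar>\<psi> x\<bar> \<le> b" using compact_support_bounded[OF \<psi>(1)] by blast
  have m: "\<psi> \<in> borel_measurable lebesgue"
    using borel_measurable_continuous_onI[OF \<psi>(1)] by (intro measurable_completion) simp
  have "integrable lebesgue (\<lambda>x. \<psi> x *\<^sub>R (indicator C x *\<^sub>R f x))"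
    using loc[OF \<psi>(2,3)] unfolding set_integrable_def by (rule integrable_scaleR_bounded[OF _ m b])
  moreover have "(\<lambda>x. \<psi> x *\<^sub>R (indicator C x *\<^sub>R f x)) = (\<lambda>x. indicator U x *\<^sub>R (f x * \<psi> x))"
    using \<psi>(3,4) by (intro ext) (auto simp: indicator_def)
  ultimately show ?thesis by (simp add: set_integrable_def)
qed

lemma integrable_indicator_compact_support:
  assumes "compact C" "set_integrable lebesgue C (f :: real^'n \<Rightarrow> 'b::euclidean_space)"
  shows "integrable lebesgue (\<lambda>x. indicator C x *\<^sub>R f x)" "\<exists>R. \<forall>x. norm x \<ge> R \<longrightarrow> indicator C x *\<^sub>R f x = 0"
proof -
  show "integrable lebesgue (\<lambda>x. indicator C x *\<^sub>R f x)" using assms(2) by (simp add: set_integrable_def)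
  obtain B where B: "\<And>x. x \<in> C \<Longrightarrow> norm x \<le> B"
    using compact_imp_bounded[OF assms(1)] unfolding bounded_iff by blast
  have "x \<notin> C" if "norm x \<ge> B + 1" for x using B[of x] that by auto
  then show "\<exists>R. \<forall>x. norm x \<ge> R \<longrightarrow> indicator C x *\<^sub>R f x = 0" by (intro exI[of _ "B + 1"]) simp
qed

text \<open>The closed neighbourhood is the Minkowski sum of \<open>C\<close> and a closed
  ball.\<close>

lemma compact_Union_cball:
  fixes C :: "'a::euclidean_space set"
  assumes "compact C"
  shows "compact (\<Union>x\<in>C. cball x d)"
proof -
  have "(\<Union>x\<in>C. cball x d) = {x + y |x y. x \<in> C \<and> y \<in> cball 0 d}"
  proof (intro set_eqI iffI)
    fix z assume "z \<in> (\<Union>x\<in>C. cball x d)"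
    then obtain x where x: "x \<in> C" "dist x z \<le> d" by auto
    then have "z = x + (z - x)" "z - x \<in> cball 0 d" by (auto simp: dist_norm norm_minus_commute)
    with x show "z \<in> {x + y |x y. x \<in> C \<and> y \<in> cball 0 d}" by blast
  next
    fix z assume "z \<in> {x + y |x y. x \<in> C \<and> y \<in> cball 0 d}"
    then obtain x y where "z = x + y" "x \<in> C" "norm y \<le> d" by auto
    then show "z \<in> (\<Union>x\<in>C. cball x d)" by (intro UN_I[of x]) (auto simp: dist_norm)
  qed
  then show ?thesis using compact_sums[OF assms compact_cball[of 0 d]] by simp
qed

text \<open>The mollifier centred at a point of \<open>U\<close> is itself a test function for small
  \<open>r\<close>, so the hypothesis says that the mollifications of \<open>h\<close> vanish there.
  Their L1 convergence gives \<open>h = 0\<close> almost everywhere on each compact subset, and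
  countably many boxes exhaust \<open>U\<close>.\<close>

lemma fundamental_lemma:
  fixes h :: "real^'n \<Rightarrow> real"
  assumes U: "open U" and loc: "\<And>C. compact C \<Longrightarrow> C \<subseteq> U \<Longrightarrow> set_integrable lebesgue C h"
    and 0: "\<And>\<psi>. \<psi> \<in> C0_inf U \<Longrightarrow> (LINT x:U|lebesgue. h x * \<psi> x) = 0"
  shows "AE x in lebesgue. x \<in> U \<longrightarrow> h x = 0"
proof -
  have K: "AE x in lebesgue. x \<in> C \<longrightarrow> h x = 0" if C: "compact C" "C \<subseteq> U" for C
  proof -
    obtain d where d: "d > 0" "(\<Union>x\<in>C. cball x d) \<subseteq> U"
      using compact_subset_open_imp_cball_epsilon_subset[OF C(1) U C(2)] by blast
    \<comment> \<open>Cutting \<open>h\<close> off outside this neighbourhood makes it integrable on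
      the whole space, without changing its mollifications at points of \<open>C\<close> for
      \<open>r < d\<close>.\<close>
    define C' where "C' = (\<Union>x\<in>C. cball x d)"
    have C': "compact C'" "C' \<subseteq> U"
      using compact_Union_cball[OF C(1), of d] d(2) by (simp_all add: C'_def)
    let ?h = "\<lambda>x. indicator C' x *\<^sub>R h x"
    have hi: "integrable lebesgue ?h" and "\<exists>R. \<forall>x. norm x \<ge> R \<longrightarrow> ?h x = 0"
      using integrable_indicator_compact_support[OF C'(1) loc[OF C']] by auto
    then have lim: "((\<lambda>r. \<integral>\<^sup>+x. ennreal (norm (conv (moll r) ?h x - ?h x)) \<partial>lebesgue) \<longlongrightarrow> 0) (at_right 0)"
      using conv_moll_L1 by blast
    have z: "conv (moll r) ?h x = 0" if r: "r \<in> {0<..<d}" and x: "x \<in> C" for r x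
    proof -
      have sub: "cball x r \<subseteq> C'" using x r by (auto simp: C'_def intro: bexI[of _ x])
      then have "(LINT y:U|lebesgue. h y * moll r (y - x)) = 0"
        using r C'(2) by (intro 0 moll_shift_C0_inf) auto
      moreover have "(moll r (x - y) *\<^sub>R ?h y) = indicator U y *\<^sub>R (h y * moll r (y - x))" for y
        using sub C'(2) moll_eq_0[of r "x - y"] r
        by (cases "y \<in> cball x r") (auto simp: moll_minus_commute[of r y x] dist_norm indicator_def)
      ultimately show ?thesis unfolding conv_def set_lebesgue_integral_def by (simp only:)
    qed
    have "(\<integral>\<^sup>+x. ennreal (norm (h x)) * indicator C x \<partial>lebesgue) \<le> 0"
    proof (rule tendsto_le[OF trivial_limit_at_right_real lim tendsto_const])
      have "eventually (\<lambda>r::real. r \<in> {0<..<d}) (at_right 0)" by (rule eventually_at_right_real[OF d(1)])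
      then show "\<forall>\<^sub>F r in at_right 0. (\<integral>\<^sup>+x. ennreal (norm (h x)) * indicator C x \<partial>lebesgue)
          \<le> (\<integral>\<^sup>+x. ennreal (norm (conv (moll r) ?h x - ?h x)) \<partial>lebesgue)"
      proof eventually_elim
        case (elim r)
        have "C \<subseteq> C'" using d(1) by (auto simp: C'_def intro!: bexI)
        then show ?case using z[OF elim] by (intro nn_integral_mono) (auto simp: indicator_def)
      qed
    qed
    moreover have "(\<lambda>x. ennreal (norm (h x)) * indicator C x) \<in> borel_measurable lebesgue"
    proof -
      have "(\<lambda>x. ennreal (norm (indicator C x *\<^sub>R h x))) \<in> borel_measurable lebesgue"
        using loc[OF C] unfolding set_integrable_def by (intro measurable_compose[OF _ measurable_ennreal] borel_measurable_norm) auto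
      also have "(\<lambda>x. ennreal (norm (indicator C x *\<^sub>R h x))) = (\<lambda>x. ennreal (norm (h x)) * indicator C x)"
        by (auto simp: indicator_def)
      finally show ?thesis .
    qed
    ultimately have "AE x in lebesgue. ennreal (norm (h x)) * indicator C x = 0"
      using nn_integral_0_iff_AE by (metis le_zero_eq)
    then show ?thesis by eventually_elim (auto simp: indicator_def)
  qed
  obtain D where D: "countable D" "\<And>X. X \<in> D \<Longrightarrow> X \<subseteq> U" "\<And>X. X \<in> D \<Longrightarrow> \<exists>a b. X = cbox a b" "\<Union>D = U"
    by (rule open_countable_Union_open_cbox[OF U]) blast
  have "AE x in lebesgue. \<forall>X\<in>D. x \<in> X \<longrightarrow> h x = 0"
  proof (intro AE_ball_countable'[OF _ D(1)] K D(2))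
    show "compact X" if "X \<in> D" for X using D(3)[OF that] by auto
  qed
  then show ?thesis by eventually_elim (use D(4) in auto)
qed

section \<open>Integration by parts for smooth functions of compact support\<close>

definition grad :: "(real^'n \<Rightarrow> real) \<Rightarrow> real^'n \<Rightarrow> real^'n" where
  "grad v x = (\<chi> i. frechet_derivative v (at x) (axis i 1))"

text \<open>By translation invariance \<open>w (x + t *\<^sub>R v) - w x\<close> has integral 0 for
  every \<open>t\<close>. Uniform differentiability on a fixed ball compares this increment with
  \<open>t\<close> times the derivative, which avoids iterated integration along lines.\<close>

lemma integral_frechet_derivative_eq_0:
  fixes w :: "real^'n \<Rightarrow> real"
  assumes c: "Ck (Suc k) w" and s: "\<And>z. norm z \<ge> R \<Longrightarrow> w z = 0"
  shows "(LINT x|lebesgue. frechet_derivative w (at x) v) = 0"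
proof -
  let ?D = "\<lambda>z. frechet_derivative w (at z)"
  \<comment> \<open>Outside this ball \<open>w\<close>, its derivative (zero from
    \<open>R + 1\<close> on) and its translates by vectors of length at most 1 all vanish.\<close>
  let ?C = "cball (0::real^'n) (\<bar>R\<bar> + 2)"
  have cont: "continuous_on UNIV w" "continuous_on UNIV (\<lambda>z. ?D z v)"
    using c Ck_imp_continuous by (blast, auto)
  have lin: "linear (?D z)" for z
    using Ck_Suc_has_derivative[OF c] has_derivative_linear by blast
  have iw: "integrable lebesgue w" by (rule integrable_continuous_compact_support[OF cont(1) s])
  have iD: "integrable lebesgue (\<lambda>z. ?D z v)"
    by (rule integrable_continuous_compact_support[OF cont(2) frechet_derivative_eq_0_outside[OF s]])
  have [measurable]: "w \<in> borel_measurable borel" by (rule borel_measurable_continuous_onI[OF cont(1)])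
  have tr: "(LINT x|lebesgue. w (x + h)) = (LINT x|lebesgue. w x)" "integrable lebesgue (\<lambda>x. w (x + h))" for h
  proof -
    have "(LINT x|lebesgue. w (x + h)) = (LINT x|lborel. w (x + h))" by (rule integral_completion) measurable
    also have "\<dots> = (LINT x|distr lborel borel ((+) h). w x)"
      by (subst integral_distr) (auto simp: add.commute)
    also have "\<dots> = (LINT x|lborel. w x)" by (simp add: lborel_distr_plus)
    also have "\<dots> = (LINT x|lebesgue. w x)" by (rule integral_completion[symmetric]) measurable
    finally show "(LINT x|lebesgue. w (x + h)) = (LINT x|lebesgue. w x)" .
    have "continuous_on UNIV (\<lambda>x. w (x + h))"
      by (intro continuous_on_compose2[OF cont(1)] continuous_intros) auto
    moreover have "w (x + h) = 0" if "norm x \<ge> \<bar>R\<bar> + norm h" for x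
      using that norm_triangle_ineq2[of x "- h"] by (intro s) auto
    ultimately show "integrable lebesgue (\<lambda>x. w (x + h))" by (rule integrable_continuous_compact_support)
  qed
  define I where "I = (LINT x|lebesgue. ?D x v)"
  have "\<bar>I\<bar> \<le> e" if "e > 0" for e
  proof -
    \<comment> \<open>Integrating the remainder over \<open>?C\<close> and dividing by
      \<open>t\<close> leaves at most \<open>e' * norm v * measure lebesgue ?C\<close>. The added
      ones keep the denominator positive.\<close>
    define e' where "e' = e / ((norm v + 1) * (measure lebesgue ?C + 1))"
    have den: "(norm v + 1) * (measure lebesgue ?C + 1) > 0" by (intro mult_pos_pos add_nonneg_pos) auto
    then have "e' > 0" using that by (simp add: e'_def)
    then obtain d where d: "d > 0" "\<And>z h. norm h < d \<Longrightarrow> \<bar>w (z + h) - w z - ?D z h\<bar> \<le> e' * norm h"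
      using Ck_uniformly_differentiable[OF c s] by blast
    define t where "t = min 1 (d / 2) / (norm v + 1)"
    have t: "t > 0" using d(1) unfolding t_def by (intro divide_pos_pos) (auto intro: add_nonneg_pos)
    have "t * norm v \<le> t * (norm v + 1)" using t by (intro mult_left_mono) auto
    also have "\<dots> = min 1 (d / 2)" unfolding t_def using norm_ge_zero[of v] by (simp add: add_nonneg_eq_0_iff)
    finally have tv: "norm (t *\<^sub>R v) < d" "norm (t *\<^sub>R v) \<le> 1" using d(1) t by auto
    have le: "\<bar>w (z + t *\<^sub>R v) - w z - t * ?D z v\<bar> \<le> e' * (t * norm v) * indicator ?C z" for z
    proof (cases "z \<in> ?C")
      case True
      then show ?thesis using d(2)[OF tv(1), of z] t by (simp add: linear_scale[OF lin])
    next
      case False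
      then have z: "norm z \<ge> \<bar>R\<bar> + 2" by auto
      then have "norm (z + t *\<^sub>R v) \<ge> R" using norm_triangle_ineq2[of z "- (t *\<^sub>R v)"] tv(2) by auto
      moreover have "?D z v = 0" using z by (intro frechet_derivative_eq_0_outside[OF s]) auto
      ultimately show ?thesis using False s[of z] s[of "z + t *\<^sub>R v"] z by simp
    qed
    have "t * \<bar>I\<bar> = \<bar>LINT z|lebesgue. w (z + t *\<^sub>R v) - w z - t * ?D z v\<bar>"
      using t by (simp add: tr iw iD I_def abs_mult)
    also have "\<dots> \<le> (LINT z|lebesgue. \<bar>w (z + t *\<^sub>R v) - w z - t * ?D z v\<bar>)"
      by (rule integral_abs_bound)
    also have "\<dots> \<le> (LINT z|lebesgue. e' * (t * norm v) * indicator ?C z)"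
    proof (rule integral_mono)
      show "integrable lebesgue (\<lambda>z. \<bar>w (z + t *\<^sub>R v) - w z - t * ?D z v\<bar>)"
        by (intro integrable_abs Bochner_Integration.integrable_diff tr iw integrable_mult_right iD)
      show "integrable lebesgue (\<lambda>z. e' * (t * norm v) * indicator ?C z)"
        using emeasure_compact_finite[of ?C] by (intro integrable_mult_right integrable_real_indicator) auto
    qed (rule le)
    also have "\<dots> = e' * (t * norm v) * measure lebesgue ?C" by simp
    also have "\<dots> \<le> e' * (t * (norm v + 1)) * (measure lebesgue ?C + 1)"
      using t \<open>e' > 0\<close> by (intro mult_mono mult_nonneg_nonneg) auto
    also have "\<dots> = t * e" unfolding e'_def using den by (simp add: field_simps)
    finally show ?thesis using t by simp
  qed
  then show ?thesis unfolding I_def by (metis abs_le_zero_iff dense_le_bounded field_le_epsilon add.left_neutral zero_less_one)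
qed

subsection \<open>Modular convergence of mollifications\<close>

text \<open>Both the power \<open>s powr p\<close> and \<open>M\<close> extended by 0 outside
  \<open>\<Omega>\<close> are instances, so that convergence in \<open>W1 p\<close> and modular
  convergence come from a single argument. Convexity is required almost everywhere only, as in
  \<open>phi_function\<close>.\<close>

locale convex_modular =
  fixes \<Phi> :: "real^'n \<Rightarrow> real \<Rightarrow> real"
  assumes nonneg: "s \<ge> 0 \<Longrightarrow> 0 \<le> \<Phi> x s"
    and meas: "s \<ge> 0 \<Longrightarrow> (\<lambda>x. \<Phi> x s) \<in> borel_measurable lebesgue"
    and AE_convex: "AE x in lebesgue. convex_on {0..} (\<Phi> x) \<and> \<Phi> x 0 = 0"
begin

context
  fixes x
  assumes x: "convex_on {0..} (\<Phi> x)" "\<Phi> x 0 = 0"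
begin

lemma scale_le:
  assumes "0 \<le> t" "t \<le> 1" "0 \<le> s"
  shows "\<Phi> x (t * s) \<le> t * \<Phi> x s"
  using convex_onD[OF x(1) assms(1,2), of 0 s] assms x(2) by simp

text \<open>Slopes of chords from the origin increase; the inequality is kept free of
  division.\<close>

lemma ratio_le:
  assumes "0 < s" "s \<le> t"
  shows "\<Phi> x s * t \<le> s * \<Phi> x t"
  using scale_le[of "s / t" t] assms by (simp add: field_simps)

lemma mono_le:
  assumes "0 \<le> s" "s \<le> t"
  shows "\<Phi> x s \<le> \<Phi> x t"
proof (cases "t = 0")
  case False
  then have "\<Phi> x s \<le> s / t * \<Phi> x t" using scale_le[of "s / t" t] assms by simp
  also have "\<dots> \<le> 1 * \<Phi> x t" using assms False by (intro mult_right_mono nonneg) auto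
  finally show ?thesis by simp
qed (use assms in simp)

text \<open>\<open>norm (a - b) / 4\<close> is at most the midpoint of \<open>norm a / 2\<close> and
  \<open>norm b / 2\<close>. The halves match the factor in the bound for mollifications.\<close>

lemma quarter_diff_le:
  "\<Phi> x (norm (a - b) / 4) \<le> \<Phi> x (norm a / 2) + \<Phi> x (norm b / 2)" for a b :: "'b::real_normed_vector"
proof -
  have "\<Phi> x (norm (a - b) / 4) \<le> \<Phi> x ((1 - 1/2) * (norm a / 2) + 1/2 * (norm b / 2))"
    using norm_triangle_ineq4[of a b] by (intro mono_le) auto
  also have "\<dots> \<le> (1 - 1/2) * \<Phi> x (norm a / 2) + 1/2 * \<Phi> x (norm b / 2)"
    using convex_onD[OF x(1), of "1/2" "norm a / 2" "norm b / 2"] by simp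
  also have "\<dots> \<le> \<Phi> x (norm a / 2) + \<Phi> x (norm b / 2)"
    using nonneg[of "norm a / 2" x] nonneg[of "norm b / 2" x] by simp
  finally show ?thesis .
qed

text \<open>Convexity and \<open>\<Phi> x 0 = 0\<close> give the linear bound
  \<open>\<Phi> x v \<le> v * \<Phi> x 1\<close> for \<open>v \<le> 1\<close>, hence continuity at
  the end point.\<close>

lemma tendsto_0:
  assumes "(\<lambda>k. v k) \<longlonglongrightarrow> 0" "\<And>k. v k \<ge> 0"
  shows "(\<lambda>k. \<Phi> x (v k)) \<longlonglongrightarrow> 0"
proof (rule Lim_null_comparison)
  show "(\<lambda>k. v k * \<Phi> x 1) \<longlonglongrightarrow> 0" using tendsto_mult_left_zero[OF assms(1)] by simp
  have "eventually (\<lambda>k. v k < 1) sequentially" using assms(1) by (intro order_tendstoD) auto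
  then show "eventually (\<lambda>k. norm (\<Phi> x (v k)) \<le> v k * \<Phi> x 1) sequentially"
    by eventually_elim (use scale_le[of _ 1] assms(2) nonneg in \<open>auto simp: less_imp_le\<close>)
qed

text \<open>Rounding to a grid of mesh \<open>1 / Suc k\<close> prepares the measurability of
  \<open>\<Phi> x (v x)\<close>. A convex function is continuous on the open half-line; at
  \<open>v = 0\<close> the rounding is exact.\<close>

lemma tendsto_floor:
  assumes "v \<ge> 0"
  shows "(\<lambda>k. \<Phi> x (real (nat \<lfloor>v * real (Suc k)\<rfloor>) / real (Suc k))) \<longlonglongrightarrow> \<Phi> x v"
proof (cases "v = 0")
  case True
  then show ?thesis using x(2) by simp
next
  case False
  have "(\<lambda>k. real (nat \<lfloor>v * real (Suc k)\<rfloor>) / real (Suc k)) \<longlonglongrightarrow> v"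
  proof (rule tendsto_sandwich)
    show "(\<lambda>k. v - 1 / real (Suc k)) \<longlonglongrightarrow> v"
      using tendsto_diff[OF tendsto_const[of v] LIMSEQ_inverse_real_of_nat] by (simp add: inverse_eq_divide)
    show "(\<lambda>k. v) \<longlonglongrightarrow> v" by simp
    show "eventually (\<lambda>k. v - 1 / real (Suc k) \<le> real (nat \<lfloor>v * real (Suc k)\<rfloor>) / real (Suc k)) sequentially"
    proof (intro always_eventually allI)
      fix k
      have "v * real (Suc k) - 1 \<le> real_of_int \<lfloor>v * real (Suc k)\<rfloor>" by linarith
      also have "\<dots> = real (nat \<lfloor>v * real (Suc k)\<rfloor>)" using assms by (simp add: of_nat_nat)
      finally show "v - 1 / real (Suc k) \<le> real (nat \<lfloor>v * real (Suc k)\<rfloor>) / real (Suc k)"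
        by (simp add: pos_le_divide_eq left_diff_distrib del: of_nat_Suc)
    qed
    show "eventually (\<lambda>k. real (nat \<lfloor>v * real (Suc k)\<rfloor>) / real (Suc k) \<le> v) sequentially"
    proof (intro always_eventually allI)
      fix k
      have "real (nat \<lfloor>v * real (Suc k)\<rfloor>) = real_of_int \<lfloor>v * real (Suc k)\<rfloor>" using assms by (simp add: of_nat_nat)
      also have "\<dots> \<le> v * real (Suc k)" by linarith
      finally show "real (nat \<lfloor>v * real (Suc k)\<rfloor>) / real (Suc k) \<le> v"
        by (simp add: pos_divide_le_eq del: of_nat_Suc)
    qed
  qed
  moreover have "continuous_on {0<..} (\<Phi> x)"
    by (rule convex_on_continuous[OF _ convex_on_subset[OF x(1)]]) auto
  then have "isCont (\<Phi> x) v"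
    using False assms by (simp add: continuous_on_eq_continuous_at)
  ultimately show ?thesis by (rule isCont_tendsto_compose[rotated])
qed

end

text \<open>After rounding, \<open>v\<close> has countably many values, and the composite is glued
  from the functions \<open>\<Phi> x s\<close> with fixed \<open>s\<close>. Continuity in
  \<open>s\<close> then passes to the limit.\<close>

lemma measurable_modular:
  assumes [measurable]: "v \<in> borel_measurable lebesgue" and v: "\<And>x. v x \<ge> 0"
  shows "(\<lambda>x. \<Phi> x (v x)) \<in> borel_measurable lebesgue"
proof -
  obtain N where N: "N \<in> null_sets lebesgue" "\<And>x. x \<notin> N \<Longrightarrow> convex_on {0..} (\<Phi> x) \<and> \<Phi> x 0 = 0"
    using AE_convex unfolding completion.AE_iff_null_sets by auto
  have [measurable]: "N \<in> sets lebesgue" using N(1) by auto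
  define g where "g k x = \<Phi> x (real (nat \<lfloor>v x * real (Suc k)\<rfloor>) / real (Suc k))" for k x
  have [measurable]: "g k \<in> borel_measurable lebesgue" for k
    unfolding g_def
  proof (rule measurable_compose_countable[where f = "\<lambda>i x. \<Phi> x (real i / real (Suc k))"])
    show "(\<lambda>x. \<Phi> x (real i / real (Suc k))) \<in> borel_measurable lebesgue" for i :: nat
      by (rule meas) simp
    show "(\<lambda>x. nat \<lfloor>v x * real (Suc k)\<rfloor>) \<in> lebesgue \<rightarrow>\<^sub>M count_space UNIV"
      by measurable
  qed
  \<comment> \<open>Continuity in \<open>s\<close> may fail on the null set \<open>N\<close>;
    completeness of the measure repairs the values there.\<close>
  have "(\<lambda>x. if x \<in> N then 0 else \<Phi> x (v x)) \<in> borel_measurable lebesgue"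
  proof (rule borel_measurable_LIMSEQ_real)
    show "(\<lambda>x. if x \<in> N then 0 else g k x) \<in> borel_measurable lebesgue" for k by measurable
    show "(\<lambda>k. if x \<in> N then 0 else g k x) \<longlonglongrightarrow> (if x \<in> N then 0 else \<Phi> x (v x))" for x
      using tendsto_floor[of x "v x"] N(2)[of x] v[of x] unfolding g_def by (cases "x \<in> N") auto
  qed
  moreover have "AE x in lebesgue. (if x \<in> N then 0 else \<Phi> x (v x)) = \<Phi> x (v x)"
    using AE_not_in[OF N(1)] by eventually_elim simp
  ultimately show ?thesis by (rule borel_measurable_AE)
qed

text \<open>
  The part of \<open>f\<close> with \<open>norm (f y) \<ge> \<tau>\<close> carries at least half of the average of \<open>norm f\<close> around
  \<open>x\<close>, and there \<open>\<Phi> y (norm (f y))\<close> dominates the chord \<open>\<Phi> y \<tau> * norm (f y) / \<tau>\<close>.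
\<close>

lemma modular_conv_moll_le:
  fixes f :: "real^'n \<Rightarrow> 'b::euclidean_space"
  defines "F \<equiv> \<lambda>y. if f y = 0 then 0 else \<Phi> y (norm (f y))"
  assumes r: "r > 0" and f: "integrable lebesgue f" and F: "integrable lebesgue F"
    and x: "\<Phi> x 0 = 0" and "C \<ge> 0"
    and \<tau>: "\<tau> = norm (conv (moll r) f x) / 2"
    and le: "\<And>y. f y \<noteq> 0 \<Longrightarrow> norm (x - y) < r \<Longrightarrow> \<Phi> x \<tau> \<le> C * \<Phi> y \<tau>"
  shows "\<Phi> x \<tau> \<le> C * conv (moll r) F x"
proof -
  have F0: "F y \<ge> 0" for y by (auto simp: F_def intro: nonneg)
  have cF0: "conv (moll r) F x \<ge> 0"
    unfolding conv_def by (intro integral_nonneg_AE AE_I2) (simp add: moll_nonneg F0)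
  show ?thesis
  proof (cases "\<tau> = 0")
    case True
    then show ?thesis using x cF0 \<open>C \<ge> 0\<close> by simp
  next
    case False
    then have "\<tau> > 0" unfolding \<tau> by simp
    have Phi0: "\<Phi> x \<tau> \<ge> 0" using \<open>\<tau> > 0\<close> by (intro nonneg) simp
    have i1: "integrable lebesgue (\<lambda>y. moll r (x - y) * norm (f y))"
      using integrable_norm[OF integrable_moll[OF r f, of x]] by (simp add: moll_nonneg)
    have i2: "integrable lebesgue (\<lambda>y. moll r (x - y) * F y)"
      using integrable_moll[OF r F, of x] by simp
    have "2 * \<tau> \<le> (LINT y|lebesgue. moll r (x - y) * norm (f y))"
      using integral_norm_bound[of lebesgue "\<lambda>y. moll r (x - y) *\<^sub>R f y"] \<tau>
      by (simp add: conv_def moll_nonneg)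
    \<comment> \<open>Subtracting \<open>\<tau>\<close> times the mass of the kernel replaces
      \<open>norm (f y)\<close> by \<open>norm (f y) - \<tau>\<close>. This is nonpositive at the
      points below \<open>\<tau>\<close>, which therefore need no comparison of
      \<open>\<Phi> x\<close> with \<open>\<Phi> y\<close>.\<close>
    then have "\<Phi> x \<tau> * \<tau> \<le> \<Phi> x \<tau> * ((LINT y|lebesgue. moll r (x - y) * norm (f y)) - \<tau> * (LINT y|lebesgue. moll r (x - y)))"
      using integral_moll(1)[OF r, of x] Phi0 by (intro mult_left_mono) auto
    also have "\<dots> = (LINT y|lebesgue. \<Phi> x \<tau> * (moll r (x - y) * norm (f y) - \<tau> * moll r (x - y)))"
      using i1 integral_moll(2)[OF r, of x] by simp
    also have "\<dots> \<le> (LINT y|lebesgue. \<tau> * C * (moll r (x - y) * F y))"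
    proof (rule integral_mono_AE)
      show "integrable lebesgue (\<lambda>y. \<Phi> x \<tau> * (moll r (x - y) * norm (f y) - \<tau> * moll r (x - y)))"
        using i1 integral_moll(2)[OF r, of x] by simp
      show "integrable lebesgue (\<lambda>y. \<tau> * C * (moll r (x - y) * F y))" using i2 by simp
      show "AE y in lebesgue. \<Phi> x \<tau> * (moll r (x - y) * norm (f y) - \<tau> * moll r (x - y)) \<le> \<tau> * C * (moll r (x - y) * F y)"
        using AE_convex
      proof eventually_elim
        case (elim y)
        have "\<Phi> x \<tau> * (norm (f y) - \<tau>) \<le> \<tau> * C * F y" if "norm (x - y) < r"
        proof (cases "norm (f y) \<le> \<tau>")
          case True
          have "\<Phi> x \<tau> * (norm (f y) - \<tau>) \<le> 0" using True Phi0 by (intro mult_nonneg_nonpos) auto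
          also have "0 \<le> \<tau> * C * F y" using \<open>\<tau> > 0\<close> \<open>C \<ge> 0\<close> F0 by simp
          finally show ?thesis .
        next
          case False
          then have fy: "f y \<noteq> 0" using \<open>\<tau> > 0\<close> by auto
          have "\<Phi> x \<tau> * (norm (f y) - \<tau>) \<le> \<Phi> x \<tau> * norm (f y)"
            using Phi0 \<open>\<tau> > 0\<close> by (intro mult_left_mono) auto
          also have "\<dots> \<le> C * \<Phi> y \<tau> * norm (f y)" by (intro mult_right_mono le fy that) auto
          also have "\<dots> = C * (\<Phi> y \<tau> * norm (f y))" by simp
          also have "\<dots> \<le> C * (\<tau> * \<Phi> y (norm (f y)))"
            using elim False \<open>\<tau> > 0\<close> \<open>C \<ge> 0\<close> by (intro mult_left_mono ratio_le) auto
          also have "\<dots> = \<tau> * C * F y" using fy by (simp add: F_def)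
          finally show ?thesis .
        qed
        from mult_left_mono[OF this moll_nonneg[of r "x - y"]]
        show ?case using moll_eq_0[OF r, of "x - y"]
          by (cases "norm (x - y) < r") (auto simp: algebra_simps)
      qed
    qed
    also have "\<dots> = \<tau> * C * conv (moll r) F x" by (simp add: conv_def)
    finally have "\<tau> * \<Phi> x \<tau> \<le> \<tau> * (C * conv (moll r) F x)" by (simp add: mult_ac)
    then show ?thesis using \<open>\<tau> > 0\<close> by simp
  qed
qed

lemma modular_conv_moll:
  fixes f :: "real^'n \<Rightarrow> 'b::euclidean_space"
  assumes f: "integrable lebesgue f" and supp: "\<And>y. norm y \<ge> R \<Longrightarrow> f y = 0"
    and Fi: "(\<integral>\<^sup>+y. ennreal (\<Phi> y (norm (f y))) \<partial>lebesgue) < \<infinity>"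
    and C: "C \<ge> 0"
    and le: "eventually (\<lambda>r. \<forall>x y. f y \<noteq> 0 \<longrightarrow> norm (x - y) < r \<longrightarrow>
        \<Phi> x (norm (conv (moll r) f x) / 2) \<le> C * \<Phi> y (norm (conv (moll r) f x) / 2)) (at_right 0)"
  shows "((\<lambda>r. \<integral>\<^sup>+x. ennreal (\<Phi> x (norm (conv (moll r) f x - f x) / 4)) \<partial>lebesgue) \<longlongrightarrow> 0) (at_right 0)"
proof -
  \<comment> \<open>Set to 0 where \<open>f\<close> vanishes: \<open>\<Phi> y 0 = 0\<close> is known
    almost everywhere only, while \<open>conv_moll_L1\<close> asks for vanishing at every point
    outside a ball.\<close>
  define F where "F = (\<lambda>y. if f y = 0 then 0 else \<Phi> y (norm (f y)))"
  have [measurable]: "f \<in> borel_measurable lebesgue" using f by auto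
  have "(\<lambda>y. \<Phi> y (norm (f y))) \<in> borel_measurable lebesgue" by (rule measurable_modular) auto
  then have [measurable]: "F \<in> borel_measurable lebesgue" unfolding F_def by measurable
  have F0: "F y \<ge> 0" for y by (auto simp: F_def intro: nonneg)
  have "(\<integral>\<^sup>+y. ennreal (F y) \<partial>lebesgue) \<le> (\<integral>\<^sup>+y. ennreal (\<Phi> y (norm (f y))) \<partial>lebesgue)"
    by (intro nn_integral_mono) (auto simp: F_def)
  then have F: "integrable lebesgue F"
    using Fi F0 by (intro integrableI_nonneg) auto
  let ?h = "\<lambda>r. \<integral>\<^sup>+x. ennreal (\<Phi> x (norm (conv (moll r) f x - f x) / 4)) \<partial>lebesgue"
  let ?e = "\<lambda>r. \<integral>\<^sup>+x. ennreal (norm (conv (moll r) f x - f x)) \<partial>lebesgue"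
  let ?E = "\<lambda>r. \<integral>\<^sup>+x. ennreal (norm (conv (moll r) F x - F x)) \<partial>lebesgue"
  have e: "(?e \<longlongrightarrow> 0) (at_right 0)" by (rule conv_moll_L1[OF f supp])
  have E: "(?E \<longlongrightarrow> 0) (at_right 0)" by (rule conv_moll_L1[OF F, of R]) (simp add: F_def supp)
  show ?thesis
  proof (rule tendsto_0_ennrealI, rule ccontr)
    fix \<epsilon> :: real assume "\<epsilon> > 0" and "\<not> eventually (\<lambda>r. ?h r \<le> ennreal \<epsilon>) (at_right 0)"
    then have freq: "frequently (\<lambda>r. \<not> ?h r \<le> ennreal \<epsilon>) (at_right 0)" by (simp add: frequently_def)
    \<comment> \<open>Dominated convergence works along sequences, so a failure of the limit is
      refuted along radii for which the L1 errors of both \<open>f\<close> and \<open>F\<close> are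
      summable.\<close>
    define good where "good k r \<longleftrightarrow> r > 0 \<and> ?e r < ennreal ((1/2) ^ k) \<and> ?E r < ennreal ((1/2) ^ k) \<and>
        (\<forall>x y. f y \<noteq> 0 \<longrightarrow> norm (x - y) < r \<longrightarrow>
        \<Phi> x (norm (conv (moll r) f x) / 2) \<le> C * \<Phi> y (norm (conv (moll r) f x) / 2))" for k r
    have "eventually (good k) (at_right 0)" for k
      unfolding good_def
      by (intro eventually_conj le order_tendstoD(2)[OF e] order_tendstoD(2)[OF E] eventually_at_right_less) simp_all
    then have "\<exists>r. good k r \<and> \<not> ?h r \<le> ennreal \<epsilon>" for k
      using frequently_ex[OF frequently_eventually_conj[OF freq, of "good k"]] by simp
    then obtain r where r: "\<And>k. good k (r k)" and big: "\<And>k. \<not> ?h (r k) \<le> ennreal \<epsilon>" by metis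
    have r0: "r k > 0" for k using r[of k] by (simp add: good_def)
    have [measurable]: "conv (moll (r k)) f \<in> borel_measurable lebesgue" "conv (moll (r k)) F \<in> borel_measurable lebesgue" for k
      by (rule measurable_conv_moll[OF r0 f], rule measurable_conv_moll[OF r0 F])
    \<comment> \<open>Finiteness of \<open>s\<close> almost everywhere gives pointwise convergence
      of the mollifications; \<open>S\<close> is integrable and dominates all errors of
      \<open>F\<close> at once.\<close>
    define s where "s x = (\<Sum>k. ennreal (norm (conv (moll (r k)) f x - f x)))" for x
    define S where "S x = (\<Sum>k. ennreal (norm (conv (moll (r k)) F x - F x)))" for x
    have [measurable]: "s \<in> borel_measurable lebesgue" "S \<in> borel_measurable lebesgue"
      unfolding s_def S_def by measurable
    have geo: "(\<Sum>k. ennreal ((1/2) ^ k)) < \<infinity>"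
      by (subst suminf_ennreal2) (auto simp: summable_geometric)
    have "(\<integral>\<^sup>+x. s x \<partial>lebesgue) = (\<Sum>k. ?e (r k))" unfolding s_def by (rule nn_integral_suminf) measurable
    also have "\<dots> \<le> (\<Sum>k. ennreal ((1/2) ^ k))"
      using r unfolding good_def by (intro suminf_le summableI less_imp_le) blast
    finally have s: "(\<integral>\<^sup>+x. s x \<partial>lebesgue) < \<infinity>" using geo by (rule le_less_trans)
    have "(\<integral>\<^sup>+x. S x \<partial>lebesgue) = (\<Sum>k. ?E (r k))" unfolding S_def by (rule nn_integral_suminf) measurable
    also have "\<dots> \<le> (\<Sum>k. ennreal ((1/2) ^ k))"
      using r unfolding good_def by (intro suminf_le summableI less_imp_le) blast
    finally have S: "(\<integral>\<^sup>+x. S x \<partial>lebesgue) < \<infinity>" using geo by (rule le_less_trans)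
    have "(\<lambda>k. ?h (r k)) \<longlonglongrightarrow> (\<integral>\<^sup>+x. 0 \<partial>(lebesgue :: (real^'n) measure))"
    proof (rule nn_integral_dominated_convergence)
      show "(\<lambda>x. ennreal (\<Phi> x (norm (conv (moll (r k)) f x - f x) / 4))) \<in> borel_measurable lebesgue" for k
        by (intro measurable_compose[OF _ measurable_ennreal] measurable_modular) auto
      \<comment> \<open>The mollified half contributes at most \<open>C\<close> times the
        mollification of \<open>F\<close>, hence at most \<open>C * (F x + S x)\<close>; the half
        from \<open>f\<close> itself contributes at most \<open>F x\<close>.\<close>
      let ?w = "\<lambda>x. ennreal C * S x + ennreal (C + 1) * ennreal (F x)"
      show "?w \<in> borel_measurable lebesgue" by measurable
      have "(\<integral>\<^sup>+x. ?w x \<partial>lebesgue) = ennreal C * (\<integral>\<^sup>+x. S x \<partial>lebesgue) + ennreal (C + 1) * (\<integral>\<^sup>+x. ennreal (F x) \<partial>lebesgue)"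
        by (simp add: nn_integral_add nn_integral_cmult)
      also have "\<dots> < \<infinity>"
        using S F F0 by (simp add: ennreal_mult_less_top integrable_iff_bounded)
      finally show "(\<integral>\<^sup>+x. ?w x \<partial>lebesgue) < \<infinity>" .
      show "AE x in lebesgue. ennreal (\<Phi> x (norm (conv (moll (r k)) f x - f x) / 4)) \<le> ?w x" for k
        using AE_convex
      proof eventually_elim
        case (elim x)
        have "\<Phi> x (norm (conv (moll (r k)) f x) / 2) \<le> C * conv (moll (r k)) F x"
          unfolding F_def
          by (rule modular_conv_moll_le[OF r0 f F[unfolded F_def] _ C refl])
             (use elim r[of k] in \<open>simp_all add: good_def\<close>)
        also have "\<dots> \<le> C * (F x + norm (conv (moll (r k)) F x - F x))"
          using C by (intro mult_left_mono) auto
        finally have 1: "\<Phi> x (norm (conv (moll (r k)) f x) / 2) \<le> C * norm (conv (moll (r k)) F x - F x) + C * F x"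
          by (simp add: algebra_simps)
        have 2: "\<Phi> x (norm (f x) / 2) \<le> F x"
          using mono_le[OF conjunct1[OF elim] conjunct2[OF elim], of "norm (f x) / 2" "norm (f x)"] elim
          by (simp add: F_def)
        have "\<Phi> x (norm (conv (moll (r k)) f x - f x) / 4) \<le> C * norm (conv (moll (r k)) F x - F x) + (C + 1) * F x"
          using quarter_diff_le[OF conjunct1[OF elim] conjunct2[OF elim], of "conv (moll (r k)) f x" "f x"] 1 2
          unfolding distrib_right mult_1 by linarith
        then have "ennreal (\<Phi> x (norm (conv (moll (r k)) f x - f x) / 4)) \<le>
            ennreal (C * norm (conv (moll (r k)) F x - F x) + (C + 1) * F x)" by (rule ennreal_leI)
        also have "\<dots> = ennreal C * ennreal (norm (conv (moll (r k)) F x - F x)) + ennreal (C + 1) * ennreal (F x)"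
          using C F0[of x] by (subst ennreal_plus) (auto simp: ennreal_mult simp del: ennreal_plus)
        also have "\<dots> \<le> ?w x"
        proof (intro add_mono mult_left_mono order_refl)
          have "(\<Sum>j\<in>{k}. ennreal (norm (conv (moll (r j)) F x - F x))) \<le> S x"
            unfolding S_def by (rule sum_le_suminf) simp_all
          then show "ennreal (norm (conv (moll (r k)) F x - F x)) \<le> S x" by simp
        qed simp_all
        finally show ?case .
      qed
      have "AE x in lebesgue. s x \<noteq> \<infinity>" using s by (intro nn_integral_PInf_AE) auto
      then show "AE x in lebesgue. (\<lambda>k. ennreal (\<Phi> x (norm (conv (moll (r k)) f x - f x) / 4))) \<longlonglongrightarrow> 0"
        using AE_convex
      proof eventually_elim
        case (elim x)
        have "summable (\<lambda>k. norm (conv (moll (r k)) f x - f x))"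
          using elim(1) unfolding s_def by (intro summable_suminf_not_top) auto
        from tendsto_divide_zero[OF summable_LIMSEQ_zero[OF this], of 4]
        have "(\<lambda>k. \<Phi> x (norm (conv (moll (r k)) f x - f x) / 4)) \<longlonglongrightarrow> 0"
          using elim(2) by (intro tendsto_0) auto
        from tendsto_ennrealI[OF this] show ?case by simp
      qed
    qed auto
    then have "eventually (\<lambda>k. ?h (r k) < ennreal \<epsilon>) sequentially"
      using \<open>\<epsilon> > 0\<close> by (intro order_tendstoD) auto
    then obtain k where "?h (r k) < ennreal \<epsilon>"
      using eventually_happens trivial_limit_sequentially by blast
    with big[of k] show False by simp
  qed
qed

end

subsection \<open>Weak gradients\<close>

lemma has_weak_gradient_locally_integrable:
  assumes "has_weak_gradient U u g" "compact C" "C \<subseteq> U"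
  shows "set_integrable lebesgue C u" "set_integrable lebesgue C g" "set_integrable lebesgue C (\<lambda>x. g x $ i)"
proof -
  show "set_integrable lebesgue C u" and g: "set_integrable lebesgue C g"
    using assms by (auto simp: has_weak_gradient_def)
  from integrable_bounded_linear[OF bounded_linear_vec_nth[of i] g[unfolded set_integrable_def]]
  show "set_integrable lebesgue C (\<lambda>x. g x $ i)" by (simp add: set_integrable_def)
qed

lemma has_weak_gradientD:
  assumes "has_weak_gradient U u g" "\<psi> \<in> C0_inf U"
  shows "(LINT x:U|lebesgue. u x * frechet_derivative \<psi> (at x) (axis i 1)) = - (LINT x:U|lebesgue. g x $ i * \<psi> x)"
    "set_integrable lebesgue U (\<lambda>x. u x * frechet_derivative \<psi> (at x) (axis i 1))"
    "set_integrable lebesgue U (\<lambda>x. g x $ i * \<psi> x)"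
proof -
  show "(LINT x:U|lebesgue. u x * frechet_derivative \<psi> (at x) (axis i 1)) = - (LINT x:U|lebesgue. g x $ i * \<psi> x)"
    using assms by (simp add: has_weak_gradient_def)
  obtain C where C: "compact C" "C \<subseteq> U" "\<And>x. x \<notin> C \<Longrightarrow> \<psi> x = 0"
    using C0_infD(2)[OF assms(2)] by blast
  have "frechet_derivative \<psi> (at x) v = 0" if "x \<notin> C" for x v
    by (rule frechet_derivative_eq_0[OF compact_imp_closed[OF C(1)] C(3) that])
  moreover have "Ck (Suc 0) \<psi>" by (rule C0_infD(1)[OF assms(2)])
  then have "continuous_on UNIV \<psi>" "continuous_on UNIV (\<lambda>x. frechet_derivative \<psi> (at x) (axis i 1))"
    using Ck_imp_continuous by (blast, simp)
  ultimately show "set_integrable lebesgue U (\<lambda>x. u x * frechet_derivative \<psi> (at x) (axis i 1))"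
    "set_integrable lebesgue U (\<lambda>x. g x $ i * \<psi> x)"
    using has_weak_gradient_locally_integrable[OF assms(1)] C
    by (auto intro!: integrable_test[where C = C])
qed

lemma has_weak_gradient_unique:
  assumes "open U" and g: "has_weak_gradient U u g" and h: "has_weak_gradient U u h"
  shows "AE x in lebesgue. x \<in> U \<longrightarrow> g x = h x"
proof -
  have "AE x in lebesgue. x \<in> U \<longrightarrow> g x $ i - h x $ i = 0" for i
  proof (rule fundamental_lemma[OF \<open>open U\<close>])
    show "set_integrable lebesgue C (\<lambda>x. g x $ i - h x $ i)" if "compact C" "C \<subseteq> U" for C
      using that by (intro set_integral_diff has_weak_gradient_locally_integrable[OF g] has_weak_gradient_locally_integrable[OF h])
    show "(LINT x:U|lebesgue. (g x $ i - h x $ i) * \<psi> x) = 0" if "\<psi> \<in> C0_inf U" for \<psi>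
      using has_weak_gradientD[OF g that, of i] has_weak_gradientD[OF h that, of i]
      by (simp add: left_diff_distrib set_integral_diff)
  qed
  then have "AE x in lebesgue. \<forall>i. x \<in> U \<longrightarrow> g x $ i - h x $ i = 0"
    by (intro AE_all_countable[THEN iffD2] allI)
  then show ?thesis by eventually_elim (simp add: vec_eq_iff)
qed

text \<open>This discharges the choice in \<open>weak_grad\<close>: any concrete weak gradient may
  be used in its place up to null sets.\<close>

lemma weak_grad_AE_eq:
  assumes "open U" "has_weak_gradient U u g"
  shows "has_weak_gradient U u (weak_grad U u)" "AE x in lebesgue. x \<in> U \<longrightarrow> weak_grad U u x = g x"
proof -
  show h: "has_weak_gradient U u (weak_grad U u)" 
    unfolding weak_grad_def by (rule someI[of "has_weak_gradient U u", OF assms(2)])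
  show "AE x in lebesgue. x \<in> U \<longrightarrow> weak_grad U u x = g x"
    by (rule has_weak_gradient_unique[OF assms(1) h assms(2)])
qed

lemma has_weak_gradient_diff:
  assumes "has_weak_gradient U u g" "has_weak_gradient U v h"
  shows "has_weak_gradient U (\<lambda>x. u x - v x) (\<lambda>x. g x - h x)"
  unfolding has_weak_gradient_def
proof (intro conjI allI impI ballI)
  fix C assume "compact C \<and> C \<subseteq> U"
  then show "set_integrable lebesgue C (\<lambda>x. u x - v x)" "set_integrable lebesgue C (\<lambda>x. g x - h x)"
    by (auto intro!: set_integral_diff has_weak_gradient_locally_integrable[OF assms(1)] has_weak_gradient_locally_integrable[OF assms(2)])
next
  fix \<psi> i assume "\<psi> \<in> C0_inf U"
  then show "(LINT x:U|lebesgue. (u x - v x) * frechet_derivative \<psi> (at x) (axis i 1)) =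
     - (LINT x:U|lebesgue. (g x - h x) $ i * \<psi> x)"
    using has_weak_gradientD[OF assms(1), of \<psi> i] has_weak_gradientD[OF assms(2), of \<psi> i]
    by (simp add: left_diff_distrib set_integral_diff)
qed

lemma set_integrable_continuous_compact:
  fixes f :: "real^'n \<Rightarrow> 'b::euclidean_space"
  assumes "continuous_on UNIV f" "compact C"
  shows "set_integrable lebesgue C f"
proof -
  have "integrable lborel (\<lambda>x. indicator C x *\<^sub>R f x)"
    by (rule borel_integrable_compact[OF assms(2) continuous_on_subset[OF assms(1) subset_UNIV]])
  then show ?thesis unfolding set_integrable_def
    by (subst integrable_completion) (auto intro: borel_measurable_integrable)
qed

text \<open>The product \<open>v * \<psi>\<close> is smooth with compact support, so its derivative
  integrates to 0; the product rule splits this into the two required integrals.\<close>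

lemma C0_inf_has_weak_gradient:
  fixes v :: "real^'n \<Rightarrow> real"
  assumes v: "v \<in> C0_inf U"
  shows "has_weak_gradient U v (grad v)"
  unfolding has_weak_gradient_def
proof (intro conjI allI impI ballI)
  have v1: "Ck (Suc 0) v" by (rule C0_infD(1)[OF v])
  have cv: "continuous_on UNIV v" "continuous_on UNIV (\<lambda>x. frechet_derivative v (at x) w)" for w :: "real^'n"
    using v1 Ck_imp_continuous by (blast, simp)
  then have "continuous_on UNIV (grad v)" unfolding grad_def by (intro continuous_on_vec_lambda)
  then show "set_integrable lebesgue C v" "set_integrable lebesgue C (grad v)" if "compact C \<and> C \<subseteq> U" for C
    using that cv by (auto intro!: set_integrable_continuous_compact)
  fix \<psi> :: "real^'n \<Rightarrow> real" and i :: 'n assume \<psi>: "\<psi> \<in> C0_inf U"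
  let ?e = "axis i 1 :: real^'n"
  have \<psi>1: "Ck (Suc 0) \<psi>" by (rule C0_infD(1)[OF \<psi>])
  have c\<psi>: "continuous_on UNIV \<psi>" "continuous_on UNIV (\<lambda>x. frechet_derivative \<psi> (at x) w)" for w
    using \<psi>1 Ck_imp_continuous by (blast, simp)
  obtain C where C: "compact C" "C \<subseteq> U" "\<And>x. x \<notin> C \<Longrightarrow> \<psi> x = 0" using C0_infD(2)[OF \<psi>] by blast
  obtain V where V: "compact V" "V \<subseteq> U" "\<And>x. x \<notin> V \<Longrightarrow> v x = 0" using C0_infD(2)[OF v] by blast
  obtain R where R: "\<And>x. norm x \<ge> R \<Longrightarrow> v x = 0" using C0_infD(3)[OF v] by blast
  have dv: "frechet_derivative v (at x) ?e = 0" if "norm x \<ge> R + 1" for x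
    by (rule frechet_derivative_eq_0_outside[OF R that])
  have fd: "frechet_derivative (\<lambda>x. v x * \<psi> x) (at x) ?e
      = v x * frechet_derivative \<psi> (at x) ?e + frechet_derivative v (at x) ?e * \<psi> x" for x
    using frechet_derivative_at[OF has_derivative_mult[OF Ck_Suc_has_derivative[OF v1] Ck_Suc_has_derivative[OF \<psi>1]], of x]
    by (simp add: fun_eq_iff)
  have i1: "integrable lebesgue (\<lambda>x. v x * frechet_derivative \<psi> (at x) ?e)"
    by (rule integrable_continuous_compact_support[of _ R]) (auto intro!: continuous_intros cv c\<psi> simp: R)
  have i2: "integrable lebesgue (\<lambda>x. frechet_derivative v (at x) ?e * \<psi> x)"
    by (rule integrable_continuous_compact_support[of _ "R + 1"]) (auto intro!: continuous_intros cv c\<psi> simp: dv)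
  have "(LINT x|lebesgue. v x * frechet_derivative \<psi> (at x) ?e + frechet_derivative v (at x) ?e * \<psi> x) = 0"
    using integral_frechet_derivative_eq_0[OF Ck_mult[OF v1 \<psi>1], of R ?e] R by (simp add: fd)
  then have eq: "(LINT x|lebesgue. v x * frechet_derivative \<psi> (at x) ?e) = - (LINT x|lebesgue. frechet_derivative v (at x) ?e * \<psi> x)"
    using i1 i2 by simp
  have "indicator U x *\<^sub>R (v x * frechet_derivative \<psi> (at x) ?e) = v x * frechet_derivative \<psi> (at x) ?e" for x
    using V(2) V(3)[of x] by (auto simp: indicator_def)
  moreover have "indicator U x *\<^sub>R (grad v x $ i * \<psi> x) = frechet_derivative v (at x) ?e * \<psi> x" for x
    using C(2) C(3)[of x] by (auto simp: indicator_def grad_def)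
  ultimately show "(LINT x:U|lebesgue. v x * frechet_derivative \<psi> (at x) ?e) = - (LINT x:U|lebesgue. grad v x $ i * \<psi> x)"
    unfolding set_lebesgue_integral_def using eq by (simp only:)
qed

text \<open>Test functions supported in \<open>U - K\<close> do not see \<open>u\<close>, so
  \<open>g\<close> integrates to 0 against them and the fundamental lemma applies on this open
  set.\<close>

lemma has_weak_gradient_AE_0:
  assumes "open U" "closed K" and g: "has_weak_gradient U u g"
    and u: "AE x in lebesgue. x \<in> U - K \<longrightarrow> u x = 0"
  shows "AE x in lebesgue. x \<in> U - K \<longrightarrow> g x = 0"
proof -
  have o: "open (U - K)" using assms by (intro open_Diff)
  have "AE x in lebesgue. x \<in> U - K \<longrightarrow> g x $ i = 0" for i
  proof (rule fundamental_lemma[OF o])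
    show "set_integrable lebesgue C (\<lambda>x. g x $ i)" if "compact C" "C \<subseteq> U - K" for C
      using that by (intro has_weak_gradient_locally_integrable[OF g]) auto
    fix \<psi> assume \<psi>: "\<psi> \<in> C0_inf (U - K)"
    then have \<psi>U: "\<psi> \<in> C0_inf U" by (rule C0_inf_mono) auto
    obtain C where C: "compact C" "C \<subseteq> U - K" "\<And>x. x \<notin> C \<Longrightarrow> \<psi> x = 0" using C0_infD(2)[OF \<psi>] by blast
    have d0: "frechet_derivative \<psi> (at x) v = 0" if "x \<notin> C" for x v
      by (rule frechet_derivative_eq_0[OF compact_imp_closed[OF C(1)] C(3) that])
    have "AE x in lebesgue. indicator U x *\<^sub>R (u x * frechet_derivative \<psi> (at x) (axis i 1)) = 0"
      using u by eventually_elim (use C(2) d0 in \<open>auto simp: indicator_def\<close>)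
    then have "(LINT x:U|lebesgue. u x * frechet_derivative \<psi> (at x) (axis i 1)) = 0"
      unfolding set_lebesgue_integral_def by (rule integral_eq_zero_AE)
    with has_weak_gradientD(1)[OF g \<psi>U] have "(LINT x:U|lebesgue. g x $ i * \<psi> x) = 0" by simp
    moreover have "indicator U x *\<^sub>R (g x $ i * \<psi> x) = indicator (U - K) x *\<^sub>R (g x $ i * \<psi> x)" for x
      using C(2) C(3)[of x] by (auto simp: indicator_def)
    ultimately show "(LINT x:U - K|lebesgue. g x $ i * \<psi> x) = 0"
      unfolding set_lebesgue_integral_def by (simp only:)
  qed
  then have "AE x in lebesgue. \<forall>i. x \<in> U - K \<longrightarrow> g x $ i = 0" by (intro AE_all_countable[THEN iffD2] allI)
  then show ?thesis by eventually_elim (simp add: vec_eq_iff)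
qed

text \<open>The essential support is relatively closed in \<open>\<Omega>\<close>; as its closure
  stays inside \<open>\<Omega>\<close>, it is closed. The Lindelof property reduces the union of
  open sets to a countable one, so the exceptional sets stay null.\<close>

lemma compact_ess_support:
  assumes "open \<Omega>" "compactly_contained (ess_support \<Omega> u) \<Omega>"
  shows "compact (ess_support \<Omega> u)" "ess_support \<Omega> u \<subseteq> \<Omega>"
    "AE x in lebesgue. x \<in> \<Omega> - ess_support \<Omega> u \<longrightarrow> u x = 0"
proof -
  let ?F = "{U. open U \<and> U \<subseteq> \<Omega> \<and> (AE x in lebesgue_on U. u x = 0)}"
  have K: "ess_support \<Omega> u = \<Omega> - \<Union>?F" by (simp add: ess_support_def)
  show "ess_support \<Omega> u \<subseteq> \<Omega>" by (auto simp: K)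
  have cl: "compact (closure (ess_support \<Omega> u))" "closure (ess_support \<Omega> u) \<subseteq> \<Omega>"
    using assms(2) by (auto simp: compactly_contained_def)
  have "closure (ess_support \<Omega> u) \<subseteq> - \<Union>?F"
    by (rule closure_minimal) (auto simp: K intro!: closed_Compl open_Union)
  with cl(2) have "closure (ess_support \<Omega> u) \<subseteq> ess_support \<Omega> u" by (auto simp: K)
  then have "closure (ess_support \<Omega> u) = ess_support \<Omega> u" using closure_subset by blast
  with cl(1) show "compact (ess_support \<Omega> u)" by simp
  obtain G where G: "G \<subseteq> ?F" "countable G" "\<Union>G = \<Union>?F"
    by (rule Lindelof[of ?F]) auto
  have "AE x in lebesgue. x \<in> U \<longrightarrow> u x = 0" if "U \<in> G" for U
  proof -
    have "open U" "AE x in lebesgue_on U. u x = 0" using that G(1) by auto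
    then show ?thesis by (subst (asm) AE_restrict_space_iff) auto
  qed
  then have "AE x in lebesgue. \<forall>U\<in>G. x \<in> U \<longrightarrow> u x = 0"
    by (intro AE_ball_countable'[OF _ G(2)])
  then show "AE x in lebesgue. x \<in> \<Omega> - ess_support \<Omega> u \<longrightarrow> u x = 0"
    by eventually_elim (use G(3) in \<open>auto simp: K\<close>)
qed

text \<open>Within distance \<open>2 * r\<close> of \<open>K\<close>, the ball of radius
  \<open>r\<close> about \<open>x\<close> stays within \<open>3 * r\<close> of \<open>K\<close>,
  hence in \<open>\<Omega>\<close>, and the kernel centred at \<open>x\<close> is an admissible test
  function. Farther away, all points of the open ball of radius \<open>r\<close> about
  \<open>x\<close> have distance at least \<open>r\<close> from \<open>K\<close>, so both sides
  vanish.\<close>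

lemma grad_conv_moll:
  fixes u :: "real^'n \<Rightarrow> real" and g :: "real^'n \<Rightarrow> real^'n"
  assumes g: "has_weak_gradient \<Omega> u g"
    and K: "compact K" "(\<Union>x\<in>K. cball x (3 * d)) \<subseteq> \<Omega>" and r: "0 < r" "r \<le> d"
    and u0: "AE x in lebesgue. x \<in> \<Omega> - K \<longrightarrow> u x = 0" and g0: "AE x in lebesgue. x \<in> \<Omega> - K \<longrightarrow> g x = 0"
  defines "U \<equiv> \<lambda>x. indicator K x *\<^sub>R u x" and "G \<equiv> \<lambda>x. indicator K x *\<^sub>R g x"
  shows "grad (conv (moll r) U) = conv (moll r) G"
proof (intro ext)
  fix x
  have KO: "K \<subseteq> \<Omega>" using K(2) r by (force intro!: centre_in_cball[THEN iffD2])
  have Ui: "integrable lebesgue U" unfolding U_def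
    by (rule integrable_indicator_compact_support(1)[OF K(1) has_weak_gradient_locally_integrable(1)[OF g K(1) KO]])
  have Gi: "integrable lebesgue G" unfolding G_def
    by (rule integrable_indicator_compact_support(1)[OF K(1) has_weak_gradient_locally_integrable(2)[OF g K(1) KO]])
  have m1: "Ck (Suc 0) (moll r :: real^'n \<Rightarrow> real)" by (rule Ck_moll)
  show "grad (conv (moll r) U) x = conv (moll r) G x"
  proof (cases "\<exists>k\<in>K. dist x k < 2 * r")
    case False
    have z: "y \<notin> K" if "norm (w - y) < r" "w \<in> ball x r" for w y
    proof
      assume "y \<in> K"
      moreover have "dist x y < 2 * r"
        using that dist_triangle[of x y w] by (simp add: dist_norm norm_minus_commute)
      ultimately show False using False by auto
    qed
    have "((\<lambda>_. 0) has_derivative (\<lambda>_. 0)) (at x)" by simp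
    then have "(conv (moll r) U has_derivative (\<lambda>_. 0)) (at x)"
    proof (rule has_derivative_transform_within_open[OF _ open_ball])
      show "x \<in> ball x r" using r by simp
      show "0 = conv (moll r) U w" if "w \<in> ball x r" for w
        by (rule sym, rule conv_moll_eq_0[OF r(1)]) (use z that in \<open>auto simp: U_def\<close>)
    qed
    then have "frechet_derivative (conv (moll r) U) (at x) = (\<lambda>_. 0)" using frechet_derivative_at by metis
    moreover have "conv (moll r) G x = 0"
      by (rule conv_moll_eq_0[OF r(1)]) (use z[of x] r in \<open>auto simp: G_def\<close>)
    ultimately show ?thesis by (simp add: grad_def vec_eq_iff)
  next
    case True
    then obtain k where k: "k \<in> K" "dist x k < 2 * r" by blast
    have "cball x r \<subseteq> cball k (3 * d)"
    proof
      fix y assume "y \<in> cball x r"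
      then show "y \<in> cball k (3 * d)" using k(2) dist_triangle[of k y x] r by (simp add: dist_commute)
    qed
    then have sub: "cball x r \<subseteq> \<Omega>" using K(2) k(1) by blast
    define \<psi> where "\<psi> = (\<lambda>y. moll r (y - x))"
    have \<psi>: "\<psi> \<in> C0_inf \<Omega>" unfolding \<psi>_def by (rule moll_shift_C0_inf[OF r(1) sub])
    \<comment> \<open>The kernel is even, and differentiating in \<open>y\<close> instead of
      \<open>x\<close> brings a minus sign, which cancels the one in the definition of the weak
      gradient.\<close>
    have d\<psi>: "frechet_derivative \<psi> (at y) v = - frechet_derivative (moll r) (at (x - y)) v" for y v
    proof -
      have "((\<lambda>y. moll r (x - y)) has_derivative (\<lambda>v. frechet_derivative (moll r) (at (x - y)) (- v))) (at y)"
        by (rule has_derivative_compose[OF _ Ck_Suc_has_derivative[OF m1]]) (auto intro!: derivative_eq_intros)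
      then have "frechet_derivative \<psi> (at y) = (\<lambda>v. frechet_derivative (moll r) (at (x - y)) (- v))"
        unfolding \<psi>_def moll_minus_commute[of r _ x] by (rule frechet_derivative_at[symmetric])
      moreover have "linear (frechet_derivative (moll r :: real^'n \<Rightarrow> real) (at (x - y)))"
        using Ck_Suc_has_derivative[OF m1] has_derivative_linear by blast
      ultimately show ?thesis by (simp add: linear_neg)
    qed
    have "conv (moll r) G x $ i = grad (conv (moll r) U) x $ i" for i
    proof -
      have iG: "integrable lebesgue (\<lambda>y. moll r (x - y) *\<^sub>R G y)" by (rule integrable_moll[OF r(1) Gi])
      have "conv (moll r) G x $ i = (LINT y|lebesgue. (moll r (x - y) *\<^sub>R G y) $ i)"
        unfolding conv_def by (rule integral_bounded_linear[OF bounded_linear_vec_nth iG, symmetric])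
      also have "\<dots> = (LINT y:\<Omega>|lebesgue. g y $ i * \<psi> y)"
        unfolding set_lebesgue_integral_def
      proof (rule integral_cong_AE)
        show "(\<lambda>y. (moll r (x - y) *\<^sub>R G y) $ i) \<in> borel_measurable lebesgue"
          using integrable_bounded_linear[OF bounded_linear_vec_nth[of i] iG] by auto
        show "(\<lambda>y. indicator \<Omega> y *\<^sub>R (g y $ i * \<psi> y)) \<in> borel_measurable lebesgue"
          using has_weak_gradientD(3)[OF g \<psi>, of i] unfolding set_integrable_def by auto
        show "AE y in lebesgue. (moll r (x - y) *\<^sub>R G y) $ i = indicator \<Omega> y *\<^sub>R (g y $ i * \<psi> y)"
          using g0
        proof eventually_elim
          case (elim y)
          then show ?case using KO
            by (auto simp: G_def \<psi>_def indicator_def moll_minus_commute[of r y x])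
        qed
      qed
      also have "\<dots> = - (LINT y:\<Omega>|lebesgue. u y * frechet_derivative \<psi> (at y) (axis i 1))"
        using has_weak_gradientD(1)[OF g \<psi>, of i] by simp
      also have "\<dots> = (LINT y|lebesgue. - (indicator \<Omega> y *\<^sub>R (u y * frechet_derivative \<psi> (at y) (axis i 1))))"
        unfolding set_lebesgue_integral_def by simp
      also have "\<dots> = conv (\<lambda>z. frechet_derivative (moll r) (at z) (axis i 1)) U x"
        unfolding conv_def
      proof (rule integral_cong_AE)
        have c: "continuous_on UNIV (\<lambda>z::real^'n. frechet_derivative (moll r) (at z) (axis i 1))"
          using m1 Ck_imp_continuous by auto
        show "(\<lambda>y. frechet_derivative (moll r) (at (x - y)) (axis i 1) *\<^sub>R U y) \<in> borel_measurable lebesgue"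
          using measurable_shift[OF c, of x] Ui by auto
        show "(\<lambda>y. - (indicator \<Omega> y *\<^sub>R (u y * frechet_derivative \<psi> (at y) (axis i 1)))) \<in> borel_measurable lebesgue"
          using has_weak_gradientD(2)[OF g \<psi>, of i] unfolding set_integrable_def by auto
        show "AE y in lebesgue. - (indicator \<Omega> y *\<^sub>R (u y * frechet_derivative \<psi> (at y) (axis i 1)))
            = frechet_derivative (moll r) (at (x - y)) (axis i 1) *\<^sub>R U y"
          using u0
        proof eventually_elim
          case (elim y)
          then show ?case using KO by (auto simp: U_def d\<psi> indicator_def)
        qed
      qed
      also have "\<dots> = grad (conv (moll r) U) x $ i"
        using frechet_derivative_at[OF conv_has_derivative[OF Ui m1 moll_eq_0[OF r(1)], where x = x]]
        by (simp add: grad_def fun_eq_iff)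
      finally show ?thesis .
    qed
    then show ?thesis by (simp add: vec_eq_iff)
  qed
qed

subsection \<open>The power modular and Musielak--Orlicz modulars\<close>

text \<open>Positive end points are covered by \<open>powr_convex\<close>; a chord ending at 0
  reduces to \<open>(c * z) powr p \<le> c * z powr p\<close>.\<close>

lemma convex_on_powr:
  fixes p :: real
  assumes "p \<ge> 1"
  shows "convex_on {0..} (\<lambda>s::real. s powr p)"
proof (rule convex_onI)
  fix t x y :: real assume t: "0 < t" "t < 1" and xy: "x \<in> {0..}" "y \<in> {0..}"
  have shrink: "(c * z) powr p \<le> c * z powr p" if "0 < c" "c < 1" "0 \<le> z" for c z :: real
  proof -
    have "c powr p \<le> c powr 1" using that assms by (intro powr_mono') auto
    then show ?thesis using that by (simp add: powr_mult mult_right_mono)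
  qed
  show "((1 - t) *\<^sub>R x + t *\<^sub>R y) powr p \<le> (1 - t) * x powr p + t * y powr p"
  proof (cases "x = 0 \<or> y = 0")
    case True
    then show ?thesis using shrink[of t y] shrink[of "1 - t" x] t xy by auto
  next
    case False
    then show ?thesis using convex_onD[OF powr_convex[OF assms], of t x y] t xy by auto
  qed
qed auto

lemma convex_modular_powr:
  assumes "p \<ge> 1"
  shows "convex_modular (\<lambda>(x :: real^'n) s. s powr p)"
  by unfold_locales (auto simp: convex_on_powr[OF assms])

text \<open>The power does not depend on the point, so the comparison hypothesis holds with constant
  1.\<close>

lemma Lp_conv_moll:
  fixes f :: "real^'n \<Rightarrow> 'b::euclidean_space"
  assumes "p > 1" "integrable lebesgue f" "\<And>y. norm y \<ge> R \<Longrightarrow> f y = 0"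
    "(\<integral>\<^sup>+y. ennreal (norm (f y) powr p) \<partial>lebesgue) < \<infinity>"
  shows "((\<lambda>r. \<integral>\<^sup>+x. ennreal ((norm (conv (moll r) f x - f x) / 4) powr p) \<partial>lebesgue) \<longlongrightarrow> 0) (at_right 0)"
proof -
  interpret convex_modular "\<lambda>(x :: real^'n) s. s powr p" using assms(1) by (intro convex_modular_powr) simp
  show ?thesis by (rule modular_conv_moll[OF assms(2,3,4), where C = 1]) auto
qed

text \<open>The pointwise modular estimate for the power, with constant 1, bounds the p-th power of
  the left side by a mollification of \<open>norm (f y) powr p\<close>, and thus by the height of
  the kernel times an integral. This is the scale at which \<open>cond_M2p\<close> controls its
  factor.\<close>

lemma norm_conv_moll_Lp_le:
  fixes f :: "real^'n \<Rightarrow> 'b::euclidean_space"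
  assumes "p > 1" "integrable lebesgue f" "(\<integral>\<^sup>+y. ennreal (norm (f y) powr p) \<partial>lebesgue) < \<infinity>"
  shows "\<exists>c>0. \<forall>r>0. \<forall>x. norm (conv (moll r) f x) / 2 \<le> c * r powr (- (real CARD('n) / p))"
proof -
  interpret convex_modular "\<lambda>(x :: real^'n) s. s powr p" using assms(1) by (intro convex_modular_powr) simp
  let ?F = "\<lambda>y. norm (f y) powr p"
  have [measurable]: "f \<in> borel_measurable lebesgue" using assms(2) by auto
  have F: "integrable lebesgue ?F" using assms(3) by (intro integrableI_nonneg) auto
  have F_eq: "(\<lambda>y. if f y = 0 then 0 else norm (f y) powr p) = ?F" by auto
  define I where "I = (LINT y|lebesgue. ?F y)"
  have "I \<ge> 0" unfolding I_def by (rule integral_nonneg_AE) auto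
  obtain A where A: "A > 0" "\<And>r z. r > 0 \<Longrightarrow> moll r (z :: real^'n) \<le> A / r ^ CARD('n)" by (rule moll_le) blast
  have "norm (conv (moll r) f x) / 2 \<le> (A * (I + 1)) powr (1 / p) * r powr (- (real CARD('n) / p))" if r: "r > 0" for r x
  proof -
    let ?\<tau> = "norm (conv (moll r) f x) / 2"
    have "?\<tau> powr p \<le> 1 * conv (moll r) ?F x"
      using modular_conv_moll_le[OF r assms(2), where x = x and C = 1 and \<tau> = "?\<tau>"] F assms(1)
      by (simp add: F_eq)
    also have "\<dots> \<le> (LINT y|lebesgue. A / r ^ CARD('n) * ?F y)"
      unfolding conv_def mult_1
    proof (rule integral_mono)
      show "integrable lebesgue (\<lambda>y. moll r (x - y) *\<^sub>R ?F y)" by (rule integrable_moll[OF r F])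
      show "integrable lebesgue (\<lambda>y. A / r ^ CARD('n) * ?F y)" by (intro integrable_mult_right F)
      show "moll r (x - y) *\<^sub>R ?F y \<le> A / r ^ CARD('n) * ?F y" for y
        unfolding real_scaleR_def by (intro mult_right_mono A(2) r) simp
    qed
    also have "\<dots> = A / r ^ CARD('n) * I" by (simp add: I_def)
    \<comment> \<open>The added 1 keeps the constant positive even if \<open>I = 0\<close>, as the
      condition on the limsup is stated for \<open>c > 0\<close>.\<close>
    also have "\<dots> \<le> A / r ^ CARD('n) * (I + 1)" using A(1) r by (intro mult_left_mono) auto
    finally have "(?\<tau> powr p) powr (1 / p) \<le> (A / r ^ CARD('n) * (I + 1)) powr (1 / p)"
      using assms(1) by (intro powr_mono2) auto
    also have "(?\<tau> powr p) powr (1 / p) = ?\<tau>" using assms(1) by (simp add: powr_powr)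
    also have "A / r ^ CARD('n) * (I + 1) = (A * (I + 1)) * r powr (- real CARD('n))"
      using r by (simp add: powr_minus powr_realpow divide_inverse)
    also have "\<dots> powr (1 / p) = (A * (I + 1)) powr (1 / p) * r powr (- (real CARD('n) / p))"
      using A(1) \<open>I \<ge> 0\<close> by (simp add: powr_mult powr_powr)
    finally show ?thesis .
  qed
  moreover have "(A * (I + 1)) powr (1 / p) > 0" using A(1) \<open>I \<ge> 0\<close> by (simp add: add_nonneg_pos)
  ultimately show ?thesis by blast
qed

text \<open>Here \<open>f k\<close> may be a chosen representative of a weak gradient, known only
  almost everywhere on \<open>\<Omega>\<close>; a measurable \<open>h k\<close> on the whole space
  stands in for it. The 4 comes from \<open>Lp_conv_moll\<close> and disappears by
  homogeneity.\<close>

lemma Lp_norm_tendsto_0: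
  fixes f h :: "nat \<Rightarrow> real^'n \<Rightarrow> 'b::euclidean_space"
  assumes "p > 1" and \<Omega>: "\<Omega> \<in> sets lebesgue"
    and m: "\<And>k. h k \<in> borel_measurable lebesgue"
    and eq: "\<And>k. AE x in lebesgue. x \<in> \<Omega> \<longrightarrow> f k x = h k x"
    and lim: "(\<lambda>k. \<integral>\<^sup>+x. ennreal ((norm (h k x) / 4) powr p) \<partial>lebesgue) \<longlonglongrightarrow> 0"
  shows "(\<lambda>k. Lp_norm p \<Omega> (f k)) \<longlonglongrightarrow> 0"
proof -
  note [measurable] = m \<Omega>
  let ?a = "\<lambda>k. \<integral>\<^sup>+x. ennreal (indicator \<Omega> x * norm (h k x) powr p) \<partial>lebesgue"
  have "(LINT x:\<Omega>|lebesgue. norm (f k x) powr p) = enn2real (?a k)" for k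
  proof -
    have [measurable]: "(\<lambda>x. if x \<in> \<Omega> then h k x else 0) \<in> borel_measurable lebesgue" by measurable
    have "AE x in lebesgue. (if x \<in> \<Omega> then h k x else 0) = (if x \<in> \<Omega> then f k x else 0)"
      using eq[of k] by eventually_elim auto
    then have [measurable]: "(\<lambda>x. if x \<in> \<Omega> then f k x else 0) \<in> borel_measurable lebesgue"
      by (rule borel_measurable_AE[rotated]) measurable
    have "(\<lambda>x. indicator \<Omega> x *\<^sub>R norm (f k x) powr p) = (\<lambda>x. indicator \<Omega> x * norm (if x \<in> \<Omega> then f k x else 0) powr p)"
      by (auto simp: indicator_def)
    also have "\<dots> \<in> borel_measurable lebesgue" by measurable
    finally have "(LINT x:\<Omega>|lebesgue. norm (f k x) powr p) = (LINT x|lebesgue. indicator \<Omega> x * norm (h k x) powr p)"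
      unfolding set_lebesgue_integral_def
    proof (rule integral_cong_AE)
      show "(\<lambda>x. indicator \<Omega> x * norm (h k x) powr p) \<in> borel_measurable lebesgue" by measurable
      show "AE x in lebesgue. indicator \<Omega> x *\<^sub>R norm (f k x) powr p = indicator \<Omega> x * norm (h k x) powr p"
        using eq[of k] by eventually_elim (auto simp: indicator_def)
    qed
    also have "\<dots> = enn2real (?a k)" by (rule integral_eq_nn_integral) auto
    finally show ?thesis .
  qed
  moreover have "(\<lambda>k. enn2real (?a k)) \<longlonglongrightarrow> 0"
  proof (rule tendsto_enn2real[where l = 0, simplified], rule tendsto_sandwich[OF _ _ tendsto_const])
    show "eventually (\<lambda>k. 0 \<le> ?a k) sequentially" by simp
    have "?a k \<le> ennreal (4 powr p) * (\<integral>\<^sup>+x. ennreal ((norm (h k x) / 4) powr p) \<partial>lebesgue)" for k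
    proof -
      have "?a k \<le> (\<integral>\<^sup>+x. ennreal (4 powr p) * ennreal ((norm (h k x) / 4) powr p) \<partial>lebesgue)"
        by (intro nn_integral_mono) (auto simp: indicator_def powr_divide simp flip: ennreal_mult)
      also have "\<dots> = ennreal (4 powr p) * (\<integral>\<^sup>+x. ennreal ((norm (h k x) / 4) powr p) \<partial>lebesgue)"
        by (rule nn_integral_cmult) measurable
      finally show ?thesis .
    qed
    then show "eventually (\<lambda>k. ?a k \<le> ennreal (4 powr p) * (\<integral>\<^sup>+x. ennreal ((norm (h k x) / 4) powr p) \<partial>lebesgue)) sequentially"
      by simp
    show "(\<lambda>k. ennreal (4 powr p) * (\<integral>\<^sup>+x. ennreal ((norm (h k x) / 4) powr p) \<partial>lebesgue)) \<longlonglongrightarrow> 0"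
      using ennreal_tendsto_cmult[OF _ lim, of "ennreal (4 powr p)"] by simp
  qed
  ultimately have "(\<lambda>k. LINT x:\<Omega>|lebesgue. norm (f k x) powr p) \<longlonglongrightarrow> 0" by simp
  then show ?thesis unfolding Lp_norm_def using assms(1)
    by (intro tendsto_zero_powrI tendsto_const)
       (auto simp: set_lebesgue_integral_def intro!: always_eventually integral_nonneg_AE)
qed

lemma convex_modular_phi_function:
  assumes "phi_function \<Omega> M" "open \<Omega>"
  shows "convex_modular (\<lambda>x s. if x \<in> \<Omega> then M x s else 0)"
proof
  have \<Omega>: "\<Omega> \<in> sets lebesgue" using assms(2) by auto
  show "0 \<le> (if x \<in> \<Omega> then M x s else 0)" if "s \<ge> 0" for x s
    using assms(1) that by (auto simp: phi_function_def)
  show "(\<lambda>x. if x \<in> \<Omega> then M x s else 0) \<in> borel_measurable lebesgue" if "s \<ge> 0" for s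
    using assms(1) that \<Omega> by (intro borel_measurable_if_I) (auto simp: phi_function_def)
  have "AE x in lebesgue_on \<Omega>. convex_on {0..} (M x) \<and> M x 0 = 0"
    using assms(1) by (simp add: phi_function_def)
  then have "AE x in lebesgue. x \<in> \<Omega> \<longrightarrow> convex_on {0..} (M x) \<and> M x 0 = 0"
    using \<Omega> by (subst (asm) AE_restrict_space_iff) auto
  then show "AE x in lebesgue. convex_on {0..} (\<lambda>s. if x \<in> \<Omega> then M x s else 0) \<and> (if x \<in> \<Omega> then M x 0 else 0) = 0"
  proof eventually_elim
    case (elim x)
    then show ?case by (cases "x \<in> \<Omega>") (auto simp: convex_on_const)
  qed
qed

text \<open>Monotonicity of the factor in its first variable replaces \<open>norm (x - y)\<close> by
  \<open>r\<close>, and monotonicity in the second replaces the height by its bound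
  \<open>c * r powr (- (N / p))\<close>. What results is the expression whose limsup is finite, and
  any natural number above that limsup serves as \<open>C\<close>.\<close>

lemma cond_M2p_conv_moll:
  fixes f :: "real^'n \<Rightarrow> 'b::euclidean_space" and M :: "real^'n \<Rightarrow> real \<Rightarrow> real"
  assumes M2: "cond_M2p \<Omega> M p" and phi: "phi_function \<Omega> M" and p: "p > 1"
    and f: "integrable lebesgue f" "(\<integral>\<^sup>+y. ennreal (norm (f y) powr p) \<partial>lebesgue) < \<infinity>"
    and supp: "\<And>y. f y \<noteq> 0 \<Longrightarrow> y \<in> \<Omega>"
  shows "\<exists>C\<ge>0. eventually (\<lambda>r. \<forall>x y. f y \<noteq> 0 \<longrightarrow> norm (x - y) < r \<longrightarrow>
    (if x \<in> \<Omega> then M x (norm (conv (moll r) f x) / 2) else 0) \<le>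
      C * (if y \<in> \<Omega> then M y (norm (conv (moll r) f x) / 2) else 0)) (at_right 0)"
proof -
  obtain c where c: "c > 0" "\<And>r x. r > 0 \<Longrightarrow> norm (conv (moll r) f x) / 2 \<le> c * r powr (- (real CARD('n) / p))"
    using norm_conv_moll_Lp_le[OF p f] by blast
  obtain \<phi> :: "real \<Rightarrow> real \<Rightarrow> real" where
      \<phi>1: "\<forall>s\<ge>0. mono_on {0..1/2} (\<lambda>r. \<phi> r s)"
    and \<phi>2: "\<forall>r\<in>{0..1/2}. mono_on {0..} (\<phi> r)"
    and \<phi>M: "\<forall>x\<in>closure \<Omega>. \<forall>y\<in>closure \<Omega>. norm (x - y) \<le> 1/2 \<longrightarrow>
          (\<forall>s\<ge>0. M x s \<le> \<phi> (norm (x - y)) s * M y s)"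
    and \<phi>L: "\<forall>c>0. Limsup (at_right 0) (\<lambda>\<epsilon>. ereal (\<phi> \<epsilon> (c * \<epsilon> powr (- (real CARD('n) / p))))) < \<infinity>"
    using M2 unfolding cond_M2p_def by (elim exE conjE) (rule that)
  from less_imp_neq[OF \<phi>L[rule_format, OF c(1)]] obtain C :: nat where "Limsup (at_right 0) (\<lambda>\<epsilon>. ereal (\<phi> \<epsilon> (c * \<epsilon> powr (- (real CARD('n) / p))))) < ereal (real C)"
    unfolding less_PInf_Ex_of_nat by (rule exE)
  then have "eventually (\<lambda>r. ereal (\<phi> r (c * r powr (- (real CARD('n) / p)))) < ereal (real C)) (at_right 0)"
    by (rule Limsup_lessD)
  moreover have "eventually (\<lambda>r::real. r \<in> {0<..<1/2}) (at_right 0)" by (intro eventually_at_right_real) simp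
  ultimately have "eventually (\<lambda>r. \<forall>x y. f y \<noteq> 0 \<longrightarrow> norm (x - y) < r \<longrightarrow>
    (if x \<in> \<Omega> then M x (norm (conv (moll r) f x) / 2) else 0) \<le>
      real C * (if y \<in> \<Omega> then M y (norm (conv (moll r) f x) / 2) else 0)) (at_right 0)"
  proof eventually_elim
    case (elim r)
    then have r: "0 < r" "r < 1/2" by auto
    show ?case
    proof (intro allI impI)
      fix x y assume y: "f y \<noteq> 0" and xy: "norm (x - y) < r"
      define \<tau> where "\<tau> = norm (conv (moll r) f x) / 2"
      have \<tau>: "\<tau> \<ge> 0" by (simp add: \<tau>_def)
      have y\<Omega>: "y \<in> \<Omega>" by (rule supp[OF y])
      have My: "M y \<tau> \<ge> 0" using phi y\<Omega> \<tau> by (auto simp: phi_function_def)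
      show "(if x \<in> \<Omega> then M x \<tau> else 0) \<le> real C * (if y \<in> \<Omega> then M y \<tau> else 0)"
      proof (cases "x \<in> \<Omega>")
        case True
        have "\<phi> (norm (x - y)) \<tau> \<le> \<phi> r \<tau>"
          using xy r by (intro mono_onD[OF \<phi>1[rule_format, OF \<tau>]]) auto
        also have "\<dots> \<le> \<phi> r (c * r powr (- (real CARD('n) / p)))"
          using c(2)[OF r(1), of x] r c(1) \<tau> by (intro mono_onD[OF bspec[OF \<phi>2]]) (auto simp: \<tau>_def)
        also have "\<dots> \<le> real C" using elim(1) by simp
        finally have "\<phi> (norm (x - y)) \<tau> * M y \<tau> \<le> real C * M y \<tau>" by (rule mult_right_mono[OF _ My])
        moreover have "M x \<tau> \<le> \<phi> (norm (x - y)) \<tau> * M y \<tau>"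
          using True y\<Omega> xy r \<tau> closure_subset[of \<Omega>] by (intro \<phi>M[rule_format]) auto
        ultimately show ?thesis using True y\<Omega> by simp
      qed (use My y\<Omega> in simp)
    qed
  qed
  then show ?thesis by (intro exI[of _ "real C"] conjI) simp_all
qed

subsection \<open>Approximation by test functions\<close>

lemma nn_integral_Lp_indicator_less_top:
  fixes f :: "real^'n \<Rightarrow> 'b::real_normed_vector"
  assumes f: "f \<in> Lp p \<Omega>" and "K \<subseteq> \<Omega>" and eq: "AE x in lebesgue. x \<in> \<Omega> \<longrightarrow> h x = f x"
  shows "(\<integral>\<^sup>+x. ennreal (norm (indicator K x *\<^sub>R h x) powr p) \<partial>lebesgue) < \<infinity>"
proof -
  have "integrable lebesgue (\<lambda>x. indicator \<Omega> x *\<^sub>R norm (f x) powr p)"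
    using f by (simp add: Lp_def set_integrable_def)
  then have "(\<integral>\<^sup>+x. ennreal (indicator \<Omega> x *\<^sub>R norm (f x) powr p) \<partial>lebesgue) < \<infinity>"
    by (simp add: integrable_iff_bounded)
  moreover have "(\<integral>\<^sup>+x. ennreal (norm (indicator K x *\<^sub>R h x) powr p) \<partial>lebesgue)
      \<le> (\<integral>\<^sup>+x. ennreal (indicator \<Omega> x *\<^sub>R norm (f x) powr p) \<partial>lebesgue)"
    using eq by (intro nn_integral_mono_AE, eventually_elim) (use \<open>K \<subseteq> \<Omega>\<close> in \<open>auto simp: indicator_def\<close>)
  ultimately show ?thesis by (rule le_less_trans[rotated])
qed

text \<open>The modular of \<open>g\<close> is finite only after division by some \<open>l\<close>,
  so the limit is taken for \<open>G / l\<close>. The quarter then produces the scale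
  \<open>4 * l\<close>.\<close>

lemma modular_convergence_conv_moll:
  fixes g :: "real^'n \<Rightarrow> 'b::euclidean_space" and M :: "real^'n \<Rightarrow> real \<Rightarrow> real"
  assumes phi: "phi_function \<Omega> M" and M2: "cond_M2p \<Omega> M p" and p: "p > 1"
    and \<Omega>: "open \<Omega>" and K: "compact K" "K \<subseteq> \<Omega>"
    and g: "g \<in> L_M \<Omega> M" and g0: "AE x in lebesgue. x \<in> \<Omega> - K \<longrightarrow> g x = 0"
  defines "G \<equiv> \<lambda>x. indicator K x *\<^sub>R g x"
  assumes G: "integrable lebesgue G" "(\<integral>\<^sup>+x. ennreal (norm (G x) powr p) \<partial>lebesgue) < \<infinity>"
    and r: "filterlim r (at_right 0) sequentially"
    and v: "\<And>k. AE x in lebesgue. x \<in> \<Omega> \<longrightarrow> v k x = conv (moll (r k)) G x"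
  shows "modular_convergence \<Omega> M v g"
proof -
  define \<Phi> where "\<Phi> x s = (if x \<in> \<Omega> then M x s else 0)" for x s
  interpret convex_modular \<Phi> unfolding \<Phi>_def by (rule convex_modular_phi_function[OF phi \<Omega>])
  obtain l where l: "l > 0" "(\<integral>\<^sup>+x\<in>\<Omega>. ennreal (M x (norm (g x) / l)) \<partial>lebesgue) < \<infinity>"
    using g by (auto simp: L_M_def)
  define f where "f x = (1 / l) *\<^sub>R G x" for x
  have fi: "integrable lebesgue f" unfolding f_def by (intro integrable_scaleR_right G)
  obtain B where B: "\<And>x. x \<in> K \<Longrightarrow> norm x \<le> B"
    using compact_imp_bounded[OF K(1)] unfolding bounded_iff by blast
  have supp: "f x = 0" if "norm x \<ge> B + 1" for x
  proof -
    have "x \<notin> K" using B[of x] that by auto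
    then show ?thesis by (simp add: f_def G_def)
  qed
  have suppK: "x \<in> \<Omega>" if "f x \<noteq> 0" for x
    using that K(2) by (auto simp: f_def G_def indicator_def split: if_splits)
  have fp: "(\<integral>\<^sup>+x. ennreal (norm (f x) powr p) \<partial>lebesgue) < \<infinity>"
  proof -
    have [measurable]: "G \<in> borel_measurable lebesgue" using G(1) by auto
    have "(\<integral>\<^sup>+x. ennreal (norm (f x) powr p) \<partial>lebesgue) = (\<integral>\<^sup>+x. ennreal ((1 / l) powr p) * ennreal (norm (G x) powr p) \<partial>lebesgue)"
      using l(1) by (intro nn_integral_cong) (simp add: f_def powr_divide flip: ennreal_mult)
    also have "\<dots> = ennreal ((1 / l) powr p) * (\<integral>\<^sup>+x. ennreal (norm (G x) powr p) \<partial>lebesgue)"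
      by (rule nn_integral_cmult) measurable
    also have "\<dots> < \<infinity>" using G(2) by (simp add: ennreal_mult_less_top)
    finally show ?thesis .
  qed
  obtain C where C: "C \<ge> 0" "eventually (\<lambda>r. \<forall>x y. f y \<noteq> 0 \<longrightarrow> norm (x - y) < r \<longrightarrow>
      \<Phi> x (norm (conv (moll r) f x) / 2) \<le> C * \<Phi> y (norm (conv (moll r) f x) / 2)) (at_right 0)"
    using cond_M2p_conv_moll[OF M2 phi p fi fp suppK] unfolding \<Phi>_def by blast
  have "(\<integral>\<^sup>+x. ennreal (\<Phi> x (norm (f x))) \<partial>lebesgue) \<le> (\<integral>\<^sup>+x\<in>\<Omega>. ennreal (M x (norm (g x) / l)) \<partial>lebesgue)"
  proof (rule nn_integral_mono_AE)
    show "AE x in lebesgue. ennreal (\<Phi> x (norm (f x))) \<le> ennreal (M x (norm (g x) / l)) * indicator \<Omega> x"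
      using g0
    proof eventually_elim
      case (elim x)
      then show ?case using l(1) K(2)
        by (cases "x \<in> K"; cases "x \<in> \<Omega>") (auto simp: \<Phi>_def f_def G_def)
    qed
  qed
  then have Fi: "(\<integral>\<^sup>+x. ennreal (\<Phi> x (norm (f x))) \<partial>lebesgue) < \<infinity>" using l(2) by (rule le_less_trans)
  have lim: "(\<lambda>k. \<integral>\<^sup>+x. ennreal (\<Phi> x (norm (conv (moll (r k)) f x - f x) / 4)) \<partial>lebesgue) \<longlonglongrightarrow> 0"
    by (rule filterlim_compose[OF modular_conv_moll[OF fi supp Fi C] r])
  have "(\<integral>\<^sup>+x\<in>\<Omega>. ennreal (M x (norm (v k x - g x) / (4 * l))) \<partial>lebesgue)
      = (\<integral>\<^sup>+x. ennreal (\<Phi> x (norm (conv (moll (r k)) f x - f x) / 4)) \<partial>lebesgue)" for k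
  proof (rule nn_integral_cong_AE)
    have cf: "conv (moll (r k)) f x - f x = (1 / l) *\<^sub>R (conv (moll (r k)) G x - G x)" for x
    proof -
      have "conv (moll (r k)) f x = (LINT y|lebesgue. (1 / l) *\<^sub>R (moll (r k) (x - y) *\<^sub>R G y))"
        unfolding conv_def f_def by (simp only: scaleR_left_commute)
      also have "\<dots> = (1 / l) *\<^sub>R conv (moll (r k)) G x"
        unfolding conv_def by (rule Bochner_Integration.integral_scaleR_right)
      finally show ?thesis by (simp only: f_def scaleR_diff_right)
    qed
    show "AE x in lebesgue. ennreal (M x (norm (v k x - g x) / (4 * l))) * indicator \<Omega> x
        = ennreal (\<Phi> x (norm (conv (moll (r k)) f x - f x) / 4))"
      using v[of k] g0
    proof eventually_elim
      case (elim x)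
      show ?case
      proof (cases "x \<in> \<Omega>")
        case True
        then have "G x = g x" "v k x = conv (moll (r k)) G x"
          using elim by (auto simp: G_def indicator_def)
        then show ?thesis using True l(1) unfolding cf by (simp add: \<Phi>_def mult.commute)
      qed (simp add: \<Phi>_def)
    qed
  qed
  with lim show ?thesis unfolding modular_convergence_def
    using l(1) by (intro exI[of _ "4 * l"]) simp
qed

theorem corollary2:
  fixes \<Omega> :: "(real^'n) set" and M :: "real^'n \<Rightarrow> real \<Rightarrow> real" and p :: real
    and u :: "real^'n \<Rightarrow> real"
  assumes "open \<Omega>" and "connected \<Omega>" and "\<Omega> \<noteq> {}" and "bounded \<Omega>"
    and "segment_property \<Omega>"
    and "N_function \<Omega> M"
    and "p > 1"
    and "cond_M1 \<Omega> M" and "cond_Gp \<Omega> M p" and "cond_M2p \<Omega> M p"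
    and "u \<in> W1_0 p \<Omega> \<inter> V1_0_L_M \<Omega> M"
    and "compactly_contained (ess_support \<Omega> u) \<Omega>"
  shows "\<exists>u_seq :: nat \<Rightarrow> real^'n \<Rightarrow> real.
    (\<forall>k. u_seq k \<in> C0_inf \<Omega>) \<and>
    (\<lambda>k. W1_norm p \<Omega> (\<lambda>x. u_seq k x - u x)) \<longlonglongrightarrow> 0 \<and>
    modular_convergence \<Omega> M (\<lambda>k. weak_grad \<Omega> (u_seq k)) (weak_grad \<Omega> u)"
proof -
  note \<Omega> = \<open>open \<Omega>\<close>
  have \<Omega>L: "\<Omega> \<in> sets lebesgue" using \<Omega> by auto
  obtain g0 where uLp: "u \<in> Lp p \<Omega>" and g0: "has_weak_gradient \<Omega> u g0" "g0 \<in> Lp p \<Omega>"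
    using assms(11) by (auto simp: W1_0_def W1_def)
  \<comment> \<open>Membership in \<open>L_M\<close> is stated for the chosen representative,
    integrability of order p for some \<open>g0\<close>; almost everywhere equality links the
    two.\<close>
  define g where "g = weak_grad \<Omega> u"
  have g: "has_weak_gradient \<Omega> u g" and gg0: "AE x in lebesgue. x \<in> \<Omega> \<longrightarrow> g x = g0 x"
    unfolding g_def using weak_grad_AE_eq[OF \<Omega> g0(1)] by auto
  have gM: "g \<in> L_M \<Omega> M" using assms(11) by (simp add: V1_0_L_M_def g_def)
  define K where "K = ess_support \<Omega> u"
  have K: "compact K" "K \<subseteq> \<Omega>" and u0: "AE x in lebesgue. x \<in> \<Omega> - K \<longrightarrow> u x = 0"
    unfolding K_def using compact_ess_support[OF \<Omega> assms(12)] by auto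
  have gz: "AE x in lebesgue. x \<in> \<Omega> - K \<longrightarrow> g x = 0"
    by (rule has_weak_gradient_AE_0[OF \<Omega> compact_imp_closed[OF K(1)] g u0])
  obtain e where e: "e > 0" "(\<Union>x\<in>K. cball x e) \<subseteq> \<Omega>"
    using compact_subset_open_imp_cball_epsilon_subset[OF K(1) \<Omega> K(2)] by blast
  \<comment> \<open>One third, since \<open>grad_conv_moll\<close> needs room \<open>3 * d\<close>
    around \<open>K\<close>.\<close>
  define d where "d = e / 3"
  have d: "d > 0" "(\<Union>x\<in>K. cball x (3 * d)) \<subseteq> \<Omega>" using e by (auto simp: d_def)
  \<comment> \<open>The indicator makes the functions vanish at every point off \<open>K\<close>,
    not just almost everywhere, and defines them on the whole space over which the convolution
    integrates.\<close>
  define U where "U = (\<lambda>x. indicator K x *\<^sub>R u x)"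
  define G where "G = (\<lambda>x. indicator K x *\<^sub>R g x)"
  have Ui: "integrable lebesgue U" and Us: "\<exists>R. \<forall>x. norm x \<ge> R \<longrightarrow> U x = 0"
    unfolding U_def using integrable_indicator_compact_support[OF K(1) has_weak_gradient_locally_integrable(1)[OF g K]] by auto
  have Gi: "integrable lebesgue G" and Gs: "\<exists>R. \<forall>x. norm x \<ge> R \<longrightarrow> G x = 0"
    unfolding G_def using integrable_indicator_compact_support[OF K(1) has_weak_gradient_locally_integrable(2)[OF g K]] by auto
  have Up: "(\<integral>\<^sup>+x. ennreal (norm (U x) powr p) \<partial>lebesgue) < \<infinity>"
    unfolding U_def by (rule nn_integral_Lp_indicator_less_top[OF uLp K(2)]) simp
  have Gp: "(\<integral>\<^sup>+x. ennreal (norm (G x) powr p) \<partial>lebesgue) < \<infinity>"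
    unfolding G_def by (rule nn_integral_Lp_indicator_less_top[OF g0(2) K(2) gg0])
  define r where "r k = d / real (Suc k)" for k
  have r: "0 < r k" "r k \<le> d" for k using d(1) by (auto simp: r_def divide_simps)
  have rlim: "filterlim r (at_right 0) sequentially"
  proof -
    have "r \<longlonglongrightarrow> 0"
      using tendsto_mult_right_zero[OF LIMSEQ_inverse_real_of_nat, of d] by (simp add: r_def[abs_def] divide_inverse)
    then show "filterlim r (at_right 0) sequentially"
      using r(1) by (intro tendsto_imp_filterlim_at_right) auto
  qed
  define w where "w k = conv (moll (r k)) U" for k
  have grad_w: "grad (w k) = conv (moll (r k)) G" for k
    unfolding w_def U_def G_def by (rule grad_conv_moll[OF g K(1) d(2) r u0 gz])
  have w: "w k \<in> C0_inf \<Omega>" for k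
  proof (rule C0_infI)
    show "Ck j (w k)" for j
      unfolding w_def by (rule Ck_conv[OF Ui Ck_moll moll_eq_0[OF r(1)]])
    show "compact (\<Union>x\<in>K. cball x d)" by (rule compact_Union_cball[OF K(1)])
    have "cball x d \<subseteq> cball x (3 * d)" for x :: "real^'n" using d(1) by (intro subset_cball) simp
    then show "(\<Union>x\<in>K. cball x d) \<subseteq> \<Omega>" using d(2) by blast
    show "w k x = 0" if x: "x \<notin> (\<Union>x\<in>K. cball x d)" for x
      unfolding w_def
    proof (rule conv_moll_eq_0[OF r(1)])
      fix y assume "norm (x - y) < r k"
      then have "x \<in> cball y d" using r(2)[of k] by (simp add: dist_norm norm_minus_commute)
      with x have "y \<notin> K" by blast
      then show "U y = 0" by (simp add: U_def)
    qed
  qed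
  have wg: "has_weak_gradient \<Omega> (w k) (conv (moll (r k)) G)" for k
    using C0_inf_has_weak_gradient[OF w, of k] by (simp add: grad_w)
  have wg_AE: "AE x in lebesgue. x \<in> \<Omega> \<longrightarrow> weak_grad \<Omega> (w k) x = conv (moll (r k)) G x" for k
    by (rule weak_grad_AE_eq(2)[OF \<Omega> wg])
  \<comment> \<open>The representative chosen for a difference need not be the difference of the
    chosen representatives, so the identity holds up to null sets only.\<close>
  have wd_AE: "AE x in lebesgue. x \<in> \<Omega> \<longrightarrow> weak_grad \<Omega> (\<lambda>x. w k x - u x) x = conv (moll (r k)) G x - G x" for k
    using weak_grad_AE_eq(2)[OF \<Omega> has_weak_gradient_diff[OF wg[of k] g]] gz
    by eventually_elim (auto simp: G_def indicator_def)
  have wu_AE: "AE x in lebesgue. x \<in> \<Omega> \<longrightarrow> w k x - u x = conv (moll (r k)) U x - U x" for k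
    using u0 by eventually_elim (auto simp: w_def U_def indicator_def)
  have "(\<lambda>k. Lp_norm p \<Omega> (\<lambda>x. w k x - u x)) \<longlonglongrightarrow> 0"
  proof (rule Lp_norm_tendsto_0[OF assms(7) \<Omega>L _ wu_AE])
    show "(\<lambda>x. conv (moll (r k)) U x - U x) \<in> borel_measurable lebesgue" for k
      using measurable_conv_moll[OF r(1)[of k] Ui] Ui by (intro borel_measurable_diff) auto
    show "(\<lambda>k. \<integral>\<^sup>+x. ennreal ((norm (conv (moll (r k)) U x - U x) / 4) powr p) \<partial>lebesgue) \<longlonglongrightarrow> 0"
      using Us Lp_conv_moll[OF assms(7) Ui _ Up] filterlim_compose[OF _ rlim] by blast
  qed
  moreover have "(\<lambda>k. Lp_norm p \<Omega> (weak_grad \<Omega> (\<lambda>x. w k x - u x))) \<longlonglongrightarrow> 0"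
  proof (rule Lp_norm_tendsto_0[OF assms(7) \<Omega>L _ wd_AE])
    show "(\<lambda>x. conv (moll (r k)) G x - G x) \<in> borel_measurable lebesgue" for k
      using measurable_conv_moll[OF r(1)[of k] Gi] Gi by (intro borel_measurable_diff) auto
    show "(\<lambda>k. \<integral>\<^sup>+x. ennreal ((norm (conv (moll (r k)) G x - G x) / 4) powr p) \<partial>lebesgue) \<longlonglongrightarrow> 0"
      using Gs Lp_conv_moll[OF assms(7) Gi _ Gp] filterlim_compose[OF _ rlim] by blast
  qed
  ultimately have "(\<lambda>k. W1_norm p \<Omega> (\<lambda>x. w k x - u x)) \<longlonglongrightarrow> 0"
    unfolding W1_norm_def using tendsto_add by fastforce
  moreover have "phi_function \<Omega> M" using assms(6) by (simp add: N_function_def Phi_function_def)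
  then have "modular_convergence \<Omega> M (\<lambda>k. weak_grad \<Omega> (w k)) g"
    using Gi Gp unfolding G_def
    by (rule modular_convergence_conv_moll[OF _ assms(10,7) \<Omega> K gM gz _ _ rlim wg_AE[unfolded G_def]])
  ultimately show ?thesis using w unfolding g_def by blast
qed

end
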